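(* Let $G\in O_n$. Then the set of $H\in O_n$ such that $G,H$ form a weakly diametral pair is the disjoint union $$\bigcup_{q=0}^{\lfloor n/2\rfloor}L_G(\mathcal{N}_{n-2q,2q}),$$ where every $L_G(\mathcal{N}_{n-2q,2q})$ is a submanifold of $O_n$, diffeomorphic to the Grassmannian $Gr(n-2q,n)$ of $(n-2q)$-dimensional vector subspaces of $\mathbb{R}^n$.
   Context: $O_n$ is the group of real orthogonal matrices of order $n$ with the Riemannian metric $g(V,W)=\operatorname{tr}(V^TW)$ induced by the Frobenius metric. Two matrices $G,H$ in the same connected component of $O_n$ form a weakly diametral pair if there is a geodesic curve $\gamma$ of $(O_n,g)$ such that $\gamma(0)=G$ and $\gamma(1)=\gamma(-1)=H$ (constant geodesics are allowed). $\mathcal{N}_{p,n-p}$ is the set of real symmetric orthogonal matrices of order $n$ with the eigenvalues $1$ of multiplicity $p$ and $-1$ of multiplicity $n-p$. $L_G$ is the left translation $X\mapsto GX$. *)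

theory Defs
  imports "HOL-Analysis.Analysis"
begin

section \<open>Smooth functions\<close>

(* Only meaningful for open S; all directional derivatives are required to be k times
   continuously differentiable. *)
primrec Ck_on :: "nat \<Rightarrow> 'a::euclidean_space set \<Rightarrow> ('a \<Rightarrow> 'b::euclidean_space) \<Rightarrow> bool" where
  "Ck_on 0 S f \<longleftrightarrow> continuous_on S f"
| "Ck_on (Suc k) S f \<longleftrightarrow>
     (\<forall>x\<in>S. f differentiable (at x)) \<and> (\<forall>v. Ck_on k S (\<lambda>x. frechet_derivative f (at x) v))"

(* Smoothness (C-infinity) on an arbitrary subset of a Euclidean space: existence of local smooth
   extensions.  On an open set this is ordinary smoothness; on a relatively open subset of a linear
   subspace K it is ordinary smoothness with respect to linear coordinates of K. *)
definition smooth_on :: "'a::euclidean_space set \<Rightarrow> ('a \<Rightarrow> 'b::euclidean_space) \<Rightarrow> bool" where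
  "smooth_on S f \<longleftrightarrow>
     (\<forall>x\<in>S. \<exists>W g. open W \<and> x \<in> W \<and> (\<forall>k. Ck_on k W g) \<and> (\<forall>y\<in>W \<inter> S. g y = f y))"


section \<open>Manifolds, submanifolds, diffeomorphisms\<close>

(* A chart is a pair of a domain U and a coordinate map that is injective on U, whose image is an
   open subset of a linear subspace of the Euclidean space 'e.  Letting the model space be a
   subspace allows the dimension to vary without changing the type.  For a nonempty domain the model
   space is the span of the image, and its dimension is dim of the image. *)
type_synonym ('a, 'e) chart = "'a set \<times> ('a \<Rightarrow> 'e)"

definition euclidean_atlas :: "('e::euclidean_space, 'e) chart set" where
  "euclidean_atlas =
     {(U, \<phi>). open U \<and> inj_on \<phi> U \<and> open (\<phi> ` U) \<and>
              smooth_on U \<phi> \<and> smooth_on (\<phi> ` U) (inv_into U \<phi>)}"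

(* Slice charts of a subset S of a manifold with (maximal) atlas A: restrictions to S of the
   charts in which S is cut out by a linear subspace K of the model space. *)
definition slice_atlas :: "('a, 'e::euclidean_space) chart set \<Rightarrow> 'a set \<Rightarrow> ('a, 'e) chart set" where
  "slice_atlas A S =
     {(U \<inter> S, \<phi>) | U \<phi>. (U, \<phi>) \<in> A \<and>
        (\<exists>K. subspace K \<and> K \<subseteq> span (\<phi> ` U) \<and> \<phi> ` (U \<inter> S) = \<phi> ` U \<inter> K)}"

(* Embedded submanifold: covered by slice charts of one dimension d.  Its smooth structure is the
   one given by slice_atlas. *)
definition submanifold :: "('a, 'e::euclidean_space) chart set \<Rightarrow> 'a set \<Rightarrow> bool" where
  "submanifold A S \<longleftrightarrow>
     (\<exists>d. \<forall>x\<in>S. \<exists>(U, \<phi>)\<in>slice_atlas A S. x \<in> U \<and> dim (\<phi> ` U) = d)"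

(* The openness condition is continuity with respect to the topologies given by the charts. *)
definition smooth_map ::
  "'a set \<Rightarrow> ('a, 'e::euclidean_space) chart set \<Rightarrow>
   'b set \<Rightarrow> ('b, 'f::euclidean_space) chart set \<Rightarrow> ('a \<Rightarrow> 'b) \<Rightarrow> bool" where
  "smooth_map M A N B F \<longleftrightarrow>
     F ` M \<subseteq> N \<and>
     (\<forall>(U, \<phi>)\<in>A. \<forall>(V, \<psi>)\<in>B.
        openin (top_of_set (\<phi> ` U)) (\<phi> ` (U \<inter> F -` V)) \<and>
        smooth_on (\<phi> ` (U \<inter> F -` V)) (\<psi> \<circ> F \<circ> inv_into U \<phi>))"

definition diffeomorphic ::
  "'a set \<Rightarrow> ('a, 'e::euclidean_space) chart set \<Rightarrow>
   'b set \<Rightarrow> ('b, 'f::euclidean_space) chart set \<Rightarrow> bool" where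
  "diffeomorphic M A N B \<longleftrightarrow>
     (\<exists>F. bij_betw F M N \<and> smooth_map M A N B F \<and> smooth_map N B M A (inv_into M F))"


section \<open>Grassmannians\<close>

definition grassmannian :: "nat \<Rightarrow> (real^'n) set set" where
  "grassmannian k = {V. subspace V \<and> dim V = k}"

(* A subspace V meeting the orthogonal complement of P trivially, with dim V = dim P, is the graph
   of a unique linear map from P to that complement; the map is encoded as the matrix T that
   extends it by zero on the complement. *)
definition graph_coord :: "(real^'n) set \<Rightarrow> (real^'n) set \<Rightarrow> real^'n^'n" where
  "graph_coord P V =
     (THE T. (\<forall>x\<in>P\<^sup>\<bottom>. T *v x = 0) \<and> (\<forall>x. T *v x \<in> P\<^sup>\<bottom>) \<and> V = (\<lambda>x. x + T *v x) ` P)"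

definition grassmannian_atlas :: "nat \<Rightarrow> ((real^'n) set, real^'n^'n) chart set" where
  "grassmannian_atlas k =
     {({V \<in> grassmannian k. V \<inter> P\<^sup>\<bottom> = {0}}, graph_coord P) | P. P \<in> grassmannian k}"


section \<open>Geodesics of submanifolds of a Euclidean space\<close>

definition tangent_space :: "'a::euclidean_space set \<Rightarrow> 'a \<Rightarrow> 'a set" where
  "tangent_space M x =
     {v. \<exists>c \<epsilon>. \<epsilon> > (0::real) \<and> smooth_on {-\<epsilon><..<\<epsilon>} c \<and> c ` {-\<epsilon><..<\<epsilon>} \<subseteq> M \<and> c 0 = x \<and>
              (c has_vector_derivative v) (at 0)}"

(* Here g is a constant inner product on the ambient space, and M carries the Riemannian metric
   induced by g.  Its Levi-Civita connection is the g-orthogonal projection of the ambient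
   derivative to the tangent spaces of M, so that the covariant derivative of the velocity along a
   curve vanishes iff the acceleration is g-normal to M. *)
definition geodesic :: "'a::euclidean_space set \<Rightarrow> ('a \<Rightarrow> 'a \<Rightarrow> real) \<Rightarrow> (real \<Rightarrow> 'a) \<Rightarrow> bool" where
  "geodesic M g \<gamma> \<longleftrightarrow>
     smooth_on UNIV \<gamma> \<and> range \<gamma> \<subseteq> M \<and>
     (\<forall>t. \<forall>v\<in>tangent_space M (\<gamma> t).
        g (vector_derivative (\<lambda>s. vector_derivative \<gamma> (at s)) (at t)) v = 0)"


section \<open>The orthogonal group\<close>

definition orthogonal_group :: "(real^'n^'n) set" where
  "orthogonal_group = {A. orthogonal_matrix A}"

definition orthogonal_group_atlas :: "(real^'n^'n, real^'n^'n) chart set" where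
  "orthogonal_group_atlas = slice_atlas euclidean_atlas orthogonal_group"

definition frobenius :: "real^'n^'n \<Rightarrow> real^'n^'n \<Rightarrow> real" where
  "frobenius V W = trace (transpose V ** W)"

definition weakly_diametral :: "real^'n^'n \<Rightarrow> real^'n^'n \<Rightarrow> bool" where
  "weakly_diametral G H \<longleftrightarrow>
     connected_component orthogonal_group G H \<and>
     (\<exists>\<gamma>. geodesic orthogonal_group frobenius \<gamma> \<and> \<gamma> 0 = G \<and> \<gamma> 1 = H \<and> \<gamma> (-1) = H)"

definition left_translation :: "real^'n^'n \<Rightarrow> real^'n^'n \<Rightarrow> real^'n^'n" where
  "left_translation G X = G ** X"

(* For symmetric matrices the multiplicity of an eigenvalue is the dimension of its eigenspace;
   multiplicity 0 means that it is not an eigenvalue. *)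
definition sym_orthogonal :: "nat \<Rightarrow> nat \<Rightarrow> (real^'n^'n) set" where
  "sym_orthogonal p m =
     {A. transpose A = A \<and> orthogonal_matrix A \<and>
         dim {x. A *v x = x} = p \<and> dim {x. A *v x = - x} = m}"

end

(* The Cayley transform A = 2 (1 + Z)^(-1) - 1, characterised by (1 + A)(1 + Z) = 2, linearises everything.
   It exchanges orthogonal and skew matrices, and for a symmetric involution Y and orthogonal Z the
   product Y Z is again a symmetric involution iff A anticommutes with Y, in which case 1 + A conjugates
   Y into Y Z.  So Z = Q^T H, H = Q Z, gives a chart of the space of all matrices around Q = G Y in which
   both the orthogonal group and the set of all G X, with X a symmetric involution with dim ker(X - 1)
   fixed, are linear.  In the graph chart of the Grassmannian at P = ker(Y - 1), the space ker(X - 1)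
   has the coordinate T = (A + A Y) / 2 with A the Cayley transform of Y X, and A = T - T^T recovers X.
   For a geodesic c, the acceleration is orthogonal to c B for all skew B, so c^T c' is both skew and
   has symmetric derivative, hence is a constant A; then Y = G^T c satisfies Y(t) Y(-t) = 1, and
   Y(1) = Y(-1) makes X = Y(1) a symmetric involution, of determinant 1 by connectedness, so that
   ker(X + 1) is even-dimensional.  Conversely, a complex structure J on ker(X + 1) gives the geodesic
   that rotates ker(X + 1) by the angle pi t. *)
theory Submission
  imports Defs
begin

section \<open>Smooth functions\<close>

text \<open>The Cayley transform is rational and is its own inverse where
  \<open>det (mat 1 + Z)\<close> is nonzero, so its smoothness reduces to Cramer's rule and the
  chart domains are open by continuity of one determinant. Relative to the splitting into ker(Y - 1)
  and ker(Y + 1), a skew matrix anticommuting with Y has the block rows (0, -B^T) and (B, 0). This B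
  is the matrix T of the graph chart, which is why both manifolds have the same linear coordinates.
  The obstacle is that \<open>slice_atlas\<close> admits every chart that flattens the subset, not
  only Cayley charts. The map sending G X to ker(X - 1) and its inverse are therefore written as
  explicit formulas on open sets of matrices, where they compose with the smooth ambient extension
  of an arbitrary chart. In these formulas the domain of a graph chart, defined by transversality,
  becomes the nonvanishing of det(1 + Y X).\<close>

declare Ck_on.simps(2) [simp del]

text \<open>Derivatives at a point depend only on a neighbourhood. On an open set equal values
  therefore give equal \<open>frechet_derivative\<close>, and the induction passes to these
  derivatives.\<close>

lemma Ck_on_cong:
  assumes "open S" "\<And>x. x \<in> S \<Longrightarrow> f x = g x" "Ck_on k S f"
  shows "Ck_on k S g"
  using assms(2,3)
proof (induction k arbitrary: f g)
  case 0
  then show ?case by (auto cong: continuous_on_cong_simp)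
next
  case (Suc k)
  have der: "(g has_derivative frechet_derivative f (at x)) (at x)" if "x \<in> S" for x
    using Suc.prems that assms(1)
    unfolding Ck_on.simps(2) frechet_derivative_works
    by (blast intro: has_derivative_transform_within_open)
  have eq: "frechet_derivative f (at x) = frechet_derivative g (at x)" if "x \<in> S" for x
    using frechet_derivative_at[OF der[OF that]] .
  have "Ck_on k S (\<lambda>x. frechet_derivative g (at x) v)" for v
    by (rule Suc.IH[of "\<lambda>x. frechet_derivative f (at x) v"])
      (use Suc.prems(2) eq in \<open>auto simp: Ck_on.simps(2)\<close>)
  then show ?case
    using der by (auto simp: Ck_on.simps(2) differentiable_def)
qed

text \<open>Lets an explicit derivative stand in for the chosen \<open>frechet_derivative\<close>,
  with which uniqueness of derivatives identifies it.\<close>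

lemma Ck_on_SucI:
  assumes "open S" "\<And>x. x \<in> S \<Longrightarrow> (f has_derivative D x) (at x)"
    and "\<And>v. Ck_on k S (\<lambda>x. D x v)"
  shows "Ck_on (Suc k) S f"
proof -
  have "D x = frechet_derivative f (at x)" if "x \<in> S" for x
    using frechet_derivative_at[OF assms(2)[OF that]] .
  then have "Ck_on k S (\<lambda>x. frechet_derivative f (at x) v)" for v
    using Ck_on_cong[OF assms(1) _ assms(3)[of v]] by simp
  then show ?thesis
    using assms(2) by (auto simp: Ck_on.simps(2) differentiable_def)
qed

lemma Ck_on_SucD:
  assumes "Ck_on (Suc k) S f" "x \<in> S"
  shows "(f has_derivative frechet_derivative f (at x)) (at x)"
  using assms by (auto simp: Ck_on.simps(2) frechet_derivative_works)

lemma Ck_on_Suc_deriv: "Ck_on (Suc k) S f \<Longrightarrow> Ck_on k S (\<lambda>x. frechet_derivative f (at x) v)"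
  by (simp add: Ck_on.simps(2))

lemma Ck_on_lower: "Ck_on (Suc k) S f \<Longrightarrow> Ck_on k S f"
proof (induction k arbitrary: f)
  case 0
  then have "f differentiable (at x)" if "x \<in> S" for x
    using that by (auto simp: Ck_on.simps(2))
  then show ?case
    by (auto intro!: continuous_at_imp_continuous_on differentiable_imp_continuous_within)
next
  case (Suc k)
  show ?case
    using Suc.prems Suc.IH[of "\<lambda>x. frechet_derivative f (at x) v" for v]
    by (simp add: Ck_on.simps(2)[of "Suc k"] Ck_on.simps(2)[of k])
qed

lemma Ck_on_continuous_on: "Ck_on k S f \<Longrightarrow> continuous_on S f"
  by (induction k) (auto dest: Ck_on_lower)

lemma Ck_on_subset: "Ck_on k S f \<Longrightarrow> T \<subseteq> S \<Longrightarrow> Ck_on k T f"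
  by (induction k arbitrary: f) (auto simp: Ck_on.simps(2) intro: continuous_on_subset)

lemma Ck_on_local:
  assumes "\<And>x. x \<in> S \<Longrightarrow> \<exists>W. open W \<and> x \<in> W \<and> Ck_on k W f"
  shows "Ck_on k S f"
  using assms
proof (induction k arbitrary: f)
  case 0
  show ?case
    unfolding Ck_on.simps
  proof (intro continuous_at_imp_continuous_on ballI)
    fix x assume "x \<in> S"
    then obtain W where "open W" "x \<in> W" "continuous_on W f"
      using 0 by auto
    then show "isCont f x"
      by (simp add: continuous_on_eq_continuous_at)
  qed
next
  case (Suc k)
  show ?case
    unfolding Ck_on.simps(2)
  proof (intro conjI allI ballI)
    show "f differentiable at x" if "x \<in> S" for x
      using Suc.prems[OF that] by (auto simp: Ck_on.simps(2))
    show "Ck_on k S (\<lambda>x. frechet_derivative f (at x) v)" for v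
    proof (rule Suc.IH)
      fix x assume "x \<in> S"
      then obtain W where "open W" "x \<in> W" "Ck_on (Suc k) W f"
        using Suc.prems by blast
      then show "\<exists>W. open W \<and> x \<in> W \<and> Ck_on k W (\<lambda>x. frechet_derivative f (at x) v)"
        using Ck_on_Suc_deriv by blast
    qed
  qed
qed

section \<open>Closure properties of the classes C^k\<close>

lemma Ck_on_const: "open S \<Longrightarrow> Ck_on k S (\<lambda>x. c)"
  by (induction k arbitrary: c) (auto simp: Ck_on.simps(2) frechet_derivative_const)

lemma Ck_on_bounded_linear:
  assumes "open S" "bounded_linear h"
  shows "Ck_on k S h"
proof (cases k)
  case 0
  then show ?thesis using assms by (simp add: linear_continuous_on)
next
  case (Suc m)
  then show ?thesis
    using Ck_on_SucI[OF assms(1) bounded_linear_imp_has_derivative[OF assms(2)] Ck_on_const[OF assms(1)]]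
    by simp
qed

lemma Ck_on_add:
  assumes "open S" "Ck_on k S f" "Ck_on k S g"
  shows "Ck_on k S (\<lambda>x. f x + g x)"
  using assms(2,3)
proof (induction k arbitrary: f g)
  case 0
  then show ?case by (auto intro: continuous_intros)
next
  case (Suc k)
  show ?case
  proof (rule Ck_on_SucI[OF assms(1)])
    show "((\<lambda>x. f x + g x) has_derivative
        (\<lambda>v. frechet_derivative f (at x) v + frechet_derivative g (at x) v)) (at x)" if "x \<in> S" for x
      using Suc.prems that by (auto intro!: has_derivative_add Ck_on_SucD)
  qed (intro Suc.IH Ck_on_Suc_deriv Suc.prems)
qed

lemma Ck_on_bilinear:
  fixes prod :: "'b::euclidean_space \<Rightarrow> 'c::euclidean_space \<Rightarrow> 'd::euclidean_space"
  assumes "bounded_bilinear prod" "open S" "Ck_on k S f" "Ck_on k S g"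
  shows "Ck_on k S (\<lambda>x. prod (f x) (g x))"
  using assms(3,4)
proof (induction k arbitrary: f g)
  case 0
  then show ?case
    using bounded_bilinear.continuous_on[OF assms(1)] by auto
next
  case (Suc k)
  show ?case
  proof (rule Ck_on_SucI[OF assms(2)])
    show "((\<lambda>x. prod (f x) (g x)) has_derivative
        (\<lambda>v. prod (f x) (frechet_derivative g (at x) v) + prod (frechet_derivative f (at x) v) (g x))) (at x)"
      if "x \<in> S" for x
      using Suc.prems that
      by (intro bounded_bilinear.FDERIV[OF assms(1)] Ck_on_SucD) auto
    show "Ck_on k S (\<lambda>x. prod (f x) (frechet_derivative g (at x) v) + prod (frechet_derivative f (at x) v) (g x))" for v
      \<comment> \<open>The product rule leaves one factor undifferentiated; it has to be lowered
        from class k + 1 to class k before the induction hypothesis applies.\<close>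
      using Suc.prems Ck_on_lower[OF Suc.prems(1)] Ck_on_lower[OF Suc.prems(2)]
      by (intro Ck_on_add[OF assms(2)] Suc.IH Ck_on_Suc_deriv)
  qed
qed

lemma Ck_on_sum:
  assumes "open S" "\<And>i. i \<in> I \<Longrightarrow> Ck_on k S (f i)"
  shows "Ck_on k S (\<lambda>x. \<Sum>i\<in>I. f i x)"
  using assms(2)
  by (induction I rule: infinite_finite_induct) (auto intro: Ck_on_const Ck_on_add assms(1))

lemma Ck_on_compose:
  fixes f :: "'a::euclidean_space \<Rightarrow> 'b::euclidean_space" and g :: "'b \<Rightarrow> 'c::euclidean_space"
  assumes "open S" "open T" "f ` S \<subseteq> T" "Ck_on k S f" "Ck_on k T g"
  shows "Ck_on k S (\<lambda>x. g (f x))"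
  using assms(4,5)
proof (induction k arbitrary: g)
  case 0
  then show ?case using assms(3) by (auto intro: continuous_on_compose2)
next
  case (Suc k)
  let ?D = "\<lambda>x v. frechet_derivative g (at (f x)) (frechet_derivative f (at x) v)"
  have Dg: "(g has_derivative frechet_derivative g (at (f x))) (at (f x))" if "x \<in> S" for x
    using Suc.prems(2) that assms(3) by (intro Ck_on_SucD) auto
  \<comment> \<open>\<open>Ck_on\<close> controls the derivative of \<open>g\<close> in a fixed
    direction, while the chain rule feeds it a direction that moves with \<open>x\<close>. Expanding
    in the basis leaves fixed directions with coefficients of class k.\<close>
  have exp: "?D x v = (\<Sum>b\<in>Basis. (frechet_derivative f (at x) v \<bullet> b) *\<^sub>R frechet_derivative g (at (f x)) b)"
    if "x \<in> S" for x v
  proof -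
    interpret bounded_linear "frechet_derivative g (at (f x))"
      using Dg[OF that] by (rule has_derivative_bounded_linear)
    have "?D x v = frechet_derivative g (at (f x)) (\<Sum>b\<in>Basis. (frechet_derivative f (at x) v \<bullet> b) *\<^sub>R b)"
      by (simp add: euclidean_representation)
    also have "\<dots> = (\<Sum>b\<in>Basis. (frechet_derivative f (at x) v \<bullet> b) *\<^sub>R frechet_derivative g (at (f x)) b)"
      by (simp only: sum scaleR)
    finally show ?thesis .
  qed
  show ?case
  proof (rule Ck_on_SucI[OF assms(1)])
    show "((\<lambda>x. g (f x)) has_derivative ?D x) (at x)" if "x \<in> S" for x
      using has_derivative_compose[OF Ck_on_SucD[OF Suc.prems(1) that] Dg[OF that]] .
    fix v
    have "Ck_on k S (\<lambda>x. \<Sum>b\<in>Basis. (frechet_derivative f (at x) v \<bullet> b) *\<^sub>R frechet_derivative g (at (f x)) b)"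
    proof (intro Ck_on_sum[OF assms(1)] Ck_on_bilinear[OF bounded_bilinear_scaleR assms(1)])
      fix b :: 'b
      show "Ck_on k S (\<lambda>x. frechet_derivative f (at x) v \<bullet> b)"
        by (intro Ck_on_bilinear[OF bounded_bilinear_inner assms(1)] Ck_on_const[OF assms(1)]
            Ck_on_Suc_deriv Suc.prems(1))
      show "Ck_on k S (\<lambda>x. frechet_derivative g (at (f x)) b)"
        by (intro Suc.IH Ck_on_lower[OF Suc.prems(1)] Ck_on_Suc_deriv Suc.prems(2))
    qed
    then show "Ck_on k S (\<lambda>x. ?D x v)"
      by (rule Ck_on_cong[OF assms(1), rotated]) (simp add: exp)
  qed
qed

section \<open>Smoothness on arbitrary sets, through local extensions\<close>

lemma smooth_onE:
  assumes "smooth_on S f" "x \<in> S"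
  obtains W g where "open W" "x \<in> W" "\<forall>k. Ck_on k W g" "\<forall>y\<in>W \<inter> S. g y = f y"
  using bspec[OF assms(1)[unfolded smooth_on_def] assms(2)] that by (elim exE conjE)

lemma smooth_on_open_iff:
  assumes "open S"
  shows "smooth_on S f \<longleftrightarrow> (\<forall>k. Ck_on k S f)"
proof
  assume f: "smooth_on S f"
  show "\<forall>k. Ck_on k S f"
  proof (intro allI Ck_on_local)
    fix k x assume "x \<in> S"
    then obtain W g where W: "open W" "x \<in> W" "\<forall>k. Ck_on k W g" "\<forall>y\<in>W \<inter> S. g y = f y"
      by (rule smooth_onE[OF f])
    have "Ck_on k (W \<inter> S) g"
      using W(3) by (blast intro: Ck_on_subset[of k W])
    then have "Ck_on k (W \<inter> S) f"
      by (rule Ck_on_cong[rotated 2]) (use W assms in auto)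
    then show "\<exists>W. open W \<and> x \<in> W \<and> Ck_on k W f"
      using W assms \<open>x \<in> S\<close> by blast
  qed
next
  assume "\<forall>k. Ck_on k S f"
  then show "smooth_on S f"
    unfolding smooth_on_def using assms by (intro ballI exI[of _ S] exI[of _ f]) simp
qed

lemma smooth_on_subset:
  assumes "smooth_on S f" "T \<subseteq> S"
  shows "smooth_on T f"
  unfolding smooth_on_def
proof
  fix x assume "x \<in> T"
  then have "x \<in> S" using assms(2) by blast
  from smooth_onE[OF assms(1) this]
  obtain W g where "open W" "x \<in> W" "\<forall>k. Ck_on k W g" "\<forall>y\<in>W \<inter> S. g y = f y" .
  then show "\<exists>W g. open W \<and> x \<in> W \<and> (\<forall>k. Ck_on k W g) \<and> (\<forall>y\<in>W \<inter> T. g y = f y)"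
    using assms(2) by (intro exI[of _ W] exI[of _ g]) auto
qed

lemma smooth_on_cong: "smooth_on S f \<Longrightarrow> (\<And>x. x \<in> S \<Longrightarrow> f x = g x) \<Longrightarrow> smooth_on S g"
  unfolding smooth_on_def by simp

lemma smooth_on_const: "smooth_on S (\<lambda>x. c)"
  by (rule smooth_on_subset[of UNIV]) (auto intro: Ck_on_const simp: smooth_on_open_iff[OF open_UNIV])

lemma smooth_on_bounded_linear: "bounded_linear h \<Longrightarrow> smooth_on S h"
  by (rule smooth_on_subset[of UNIV])
    (auto intro: Ck_on_bounded_linear simp: smooth_on_open_iff[OF open_UNIV])

lemma smooth_on_id: "smooth_on S (\<lambda>x. x)"
  by (rule smooth_on_bounded_linear[OF bounded_linear_ident])

lemma smooth_on_compose:
  assumes f: "smooth_on S f" and g: "smooth_on T g" and "f ` S \<subseteq> T"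
  shows "smooth_on S (\<lambda>x. g (f x))"
  unfolding smooth_on_def
proof
  fix x assume "x \<in> S"
  obtain W f' where W: "open W" "x \<in> W" "\<forall>k. Ck_on k W f'" "\<forall>y\<in>W \<inter> S. f' y = f y"
    by (rule smooth_onE[OF f \<open>x \<in> S\<close>])
  have "f x \<in> T"
    using \<open>x \<in> S\<close> assms(3) by blast
  then obtain U g' where U: "open U" "f x \<in> U" "\<forall>k. Ck_on k U g'" "\<forall>y\<in>U \<inter> T. g' y = g y"
    by (rule smooth_onE[OF g])
  \<comment> \<open>The extensions compose only where the extension \<open>f'\<close>, and not
    merely \<open>f\<close>, takes values in \<open>U\<close>.\<close>
  let ?W = "W \<inter> f' -` U"
  have "open ?W"
    using continuous_open_preimage[OF Ck_on_continuous_on[of 0 W f'] W(1) U(1)] W(3) by blast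
  moreover have "x \<in> ?W" using W U \<open>x \<in> S\<close> by auto
  moreover have "\<forall>k. Ck_on k ?W (\<lambda>x. g' (f' x))"
  proof
    fix k
    show "Ck_on k ?W (\<lambda>x. g' (f' x))"
      by (rule Ck_on_compose[OF \<open>open ?W\<close> U(1)])
        (use W(3) U(3) Ck_on_subset[of k W f' ?W] in auto)
  qed
  moreover have "\<forall>y\<in>?W \<inter> S. g' (f' y) = g (f y)"
    using W U assms(3) by auto
  ultimately show "\<exists>W h. open W \<and> x \<in> W \<and> (\<forall>k. Ck_on k W h) \<and> (\<forall>y\<in>W \<inter> S. h y = g (f y))"
    by blast
qed

lemma smooth_on_bilinear:
  fixes prod :: "'b::euclidean_space \<Rightarrow> 'c::euclidean_space \<Rightarrow> 'd::euclidean_space"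
  assumes "bounded_bilinear prod" "smooth_on S f" "smooth_on S g"
  shows "smooth_on S (\<lambda>x. prod (f x) (g x))"
  unfolding smooth_on_def
proof
  fix x assume "x \<in> S"
  obtain W f' where W: "open W" "x \<in> W" "\<forall>k. Ck_on k W f'" "\<forall>y\<in>W \<inter> S. f' y = f y"
    by (rule smooth_onE[OF assms(2) \<open>x \<in> S\<close>])
  obtain U g' where U: "open U" "x \<in> U" "\<forall>k. Ck_on k U g'" "\<forall>y\<in>U \<inter> S. g' y = g y"
    by (rule smooth_onE[OF assms(3) \<open>x \<in> S\<close>])
  show "\<exists>W h. open W \<and> x \<in> W \<and> (\<forall>k. Ck_on k W h) \<and> (\<forall>y\<in>W \<inter> S. h y = prod (f y) (g y))"
    using W U
    by (intro exI[of _ "W \<inter> U"] exI[of _ "\<lambda>x. prod (f' x) (g' x)"])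
      (auto intro!: Ck_on_bilinear[OF assms(1)] Ck_on_subset[of _ W f' "W \<inter> U"] Ck_on_subset[of _ U g' "W \<inter> U"])
qed

lemma smooth_on_linear_compose:
  fixes h :: "'b::euclidean_space \<Rightarrow> 'c::euclidean_space"
  assumes "linear h" "smooth_on S f"
  shows "smooth_on S (\<lambda>x. h (f x))"
  using smooth_on_compose[OF assms(2) smooth_on_bounded_linear[of h UNIV]] assms(1)
  by (simp add: linear_conv_bounded_linear)

lemma smooth_on_add:
  assumes "smooth_on S f" "smooth_on S g"
  shows "smooth_on S (\<lambda>x. f x + g x)"
  unfolding smooth_on_def
proof
  fix x assume "x \<in> S"
  obtain W f' where W: "open W" "x \<in> W" "\<forall>k. Ck_on k W f'" "\<forall>y\<in>W \<inter> S. f' y = f y"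
    by (rule smooth_onE[OF assms(1) \<open>x \<in> S\<close>])
  obtain U g' where U: "open U" "x \<in> U" "\<forall>k. Ck_on k U g'" "\<forall>y\<in>U \<inter> S. g' y = g y"
    by (rule smooth_onE[OF assms(2) \<open>x \<in> S\<close>])
  show "\<exists>W h. open W \<and> x \<in> W \<and> (\<forall>k. Ck_on k W h) \<and> (\<forall>y\<in>W \<inter> S. h y = f y + g y)"
    using W U
    by (intro exI[of _ "W \<inter> U"] exI[of _ "\<lambda>x. f' x + g' x"])
      (auto intro!: Ck_on_add Ck_on_subset[of _ W f' "W \<inter> U"] Ck_on_subset[of _ U g' "W \<inter> U"])
qed

lemma smooth_on_scaleR_left: "smooth_on S f \<Longrightarrow> smooth_on S (\<lambda>x. c *\<^sub>R f x)"
  by (rule smooth_on_linear_compose) (auto simp: linear_iff algebra_simps)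

lemma smooth_on_diff: "smooth_on S f \<Longrightarrow> smooth_on S g \<Longrightarrow> smooth_on S (\<lambda>x. f x - g x)"
  using smooth_on_add[of S f "\<lambda>x. (-1) *\<^sub>R g x"] smooth_on_scaleR_left[of S g "-1"] by simp

lemma smooth_on_sum:
  "(\<And>i. i \<in> I \<Longrightarrow> smooth_on S (f i)) \<Longrightarrow> smooth_on S (\<lambda>x. \<Sum>i\<in>I. f i x)"
  by (induction I rule: infinite_finite_induct) (auto intro: smooth_on_const smooth_on_add)

lemma smooth_on_mult:
  fixes f g :: "'a::euclidean_space \<Rightarrow> real"
  shows "smooth_on S f \<Longrightarrow> smooth_on S g \<Longrightarrow> smooth_on S (\<lambda>x. f x * g x)"
  by (rule smooth_on_bilinear[OF bounded_bilinear_mult])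

lemma smooth_on_prod:
  fixes f :: "'i \<Rightarrow> 'a::euclidean_space \<Rightarrow> real"
  shows "(\<And>i. i \<in> I \<Longrightarrow> smooth_on S (f i)) \<Longrightarrow> smooth_on S (\<lambda>x. \<Prod>i\<in>I. f i x)"
  by (induction I rule: infinite_finite_induct) (auto intro: smooth_on_const smooth_on_mult)

lemma smooth_on_vec_lambda:
  fixes f :: "'n::finite \<Rightarrow> 'a::euclidean_space \<Rightarrow> 'b::euclidean_space"
  assumes "\<And>i. smooth_on S (f i)"
  shows "smooth_on S (\<lambda>x. \<chi> i. f i x)"
proof -
  have lin: "linear (\<lambda>y::'b. axis i y :: 'b^'n)" for i
    by (auto simp: linear_iff axis_def vec_eq_iff)
  have "smooth_on S (\<lambda>x. \<Sum>i\<in>UNIV. axis i (f i x) :: 'b^'n)"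
    by (rule smooth_on_sum) (rule smooth_on_linear_compose[OF lin assms])
  then show ?thesis
    by (rule smooth_on_cong) (auto simp: vec_eq_iff axis_def)
qed

lemma smooth_on_nth: "smooth_on S f \<Longrightarrow> smooth_on S (\<lambda>x. f x $ i)"
  by (rule smooth_on_linear_compose) (auto simp: linear_iff)

text \<open>The derivative is a polynomial in \<open>inverse\<close> itself, so class k of the
  function gives class k of its derivative.\<close>

lemma smooth_on_inverse_real: "smooth_on {x::real. x \<noteq> 0} inverse"
proof -
  have op: "open {x::real. x \<noteq> 0}"
    by (rule open_Collect_neq) (auto intro: continuous_intros)
  have "Ck_on k {x::real. x \<noteq> 0} inverse" for k
  proof (induction k)
    case 0
    then show ?case by (auto intro!: continuous_intros)
  next
    case (Suc k)
    show ?case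
    proof (rule Ck_on_SucI[OF op])
      show "(inverse has_derivative (\<lambda>v. - (inverse x * v * inverse x))) (at x)"
        if "x \<in> {x::real. x \<noteq> 0}" for x
        using that by (auto intro: has_derivative_inverse')
      show "Ck_on k {x::real. x \<noteq> 0} (\<lambda>x. - (inverse x * v * inverse x))" for v
        using Ck_on_bilinear[OF bounded_bilinear_mult op
          Ck_on_bilinear[OF bounded_bilinear_mult op Suc Suc] Ck_on_const[OF op, of k "-v"]]
        by (simp add: ac_simps)
    qed
  qed
  then show ?thesis by (simp add: smooth_on_open_iff[OF op])
qed

lemma smooth_on_divide:
  fixes f g :: "'a::euclidean_space \<Rightarrow> real"
  assumes "smooth_on S f" "smooth_on S g" "\<And>x. x \<in> S \<Longrightarrow> g x \<noteq> 0"
  shows "smooth_on S (\<lambda>x. f x / g x)"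
  unfolding divide_inverse
  using assms by (intro smooth_on_mult smooth_on_compose[OF _ smooth_on_inverse_real]) auto

lemma smooth_on_det:
  fixes f :: "'a::euclidean_space \<Rightarrow> real^'n^'n"
  assumes "smooth_on S f"
  shows "smooth_on S (\<lambda>x. det (f x))"
  unfolding det_def
  by (intro smooth_on_sum smooth_on_mult smooth_on_const smooth_on_prod smooth_on_nth assms)

section \<open>Smoothness of matrix operations\<close>

lemma bounded_bilinear_matrix_mult:
  "bounded_bilinear ((**) :: real^'n^'n \<Rightarrow> real^'n^'n \<Rightarrow> real^'n^'n)"
  unfolding bilinear_conv_bounded_bilinear[symmetric] bilinear_def linear_iff
  by (auto simp: matrix_matrix_mult_def vec_eq_iff algebra_simps sum.distrib sum_distrib_left)

lemma bounded_bilinear_matrix_vector_mult: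
  "bounded_bilinear ((*v) :: real^'n^'n \<Rightarrow> real^'n \<Rightarrow> real^'n)"
  unfolding bilinear_conv_bounded_bilinear[symmetric] bilinear_def linear_iff
  by (auto simp: matrix_vector_mult_def vec_eq_iff algebra_simps sum.distrib sum_distrib_left)

lemmas smooth_on_matrix_mult = smooth_on_bilinear[OF bounded_bilinear_matrix_mult]

lemma smooth_on_transpose:
  fixes f :: "'a::euclidean_space \<Rightarrow> real^'n^'n"
  assumes "smooth_on S f"
  shows "smooth_on S (\<lambda>x. transpose (f x))"
  unfolding transpose_def
  by (intro smooth_on_vec_lambda smooth_on_nth assms)

lemma matrix_inv_right:
  fixes A :: "real^'n^'n"
  assumes "det A \<noteq> 0"
  shows "A ** matrix_inv A = mat 1"
  using assms someI_ex[of "\<lambda>B. A ** B = mat 1 \<and> B ** A = mat 1"]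
  unfolding matrix_inv_def invertible_det_nz[symmetric] invertible_def by blast

lemma matrix_inv_left:
  fixes A :: "real^'n^'n"
  shows "det A \<noteq> 0 \<Longrightarrow> matrix_inv A ** A = mat 1"
  using matrix_inv_right matrix_left_right_inverse by blast

text \<open>Cramer's rule applied to each column of the inverse. It exhibits the entries as
  quotients of polynomials in the entries of \<open>A\<close>, from which smoothness of inversion
  follows formally.\<close>

lemma matrix_inv_cramer:
  fixes A :: "real^'n^'n"
  assumes "det A \<noteq> 0"
  shows "matrix_inv A $ k $ j = det (\<chi> i l. if l = k then axis j 1 $ i else A $ i $ l) / det A"
proof -
  have "A *v column j (matrix_inv A) = axis j 1"
    by (metis assms matrix_inv_right matrix_vector_mul_assoc matrix_vector_mul_lid matrix_vector_mult_basis)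
  then have "column j (matrix_inv A) = (\<chi> k. det (\<chi> i l. if l = k then axis j 1 $ i else A $ i $ l) / det A)"
    using cramer[OF assms] by blast
  then show ?thesis
    by (simp add: column_def vec_eq_iff)
qed

lemma smooth_on_matrix_inv:
  fixes f :: "'a::euclidean_space \<Rightarrow> real^'n^'n"
  assumes "smooth_on S f" "\<And>x. x \<in> S \<Longrightarrow> det (f x) \<noteq> 0"
  shows "smooth_on S (\<lambda>x. matrix_inv (f x))"
proof -
  have e: "smooth_on S (\<lambda>x. if l = k then axis j 1 $ i else f x $ i $ l)" for i j k l :: 'n
    using smooth_on_nth[OF smooth_on_nth[OF assms(1)]]
    by (cases "l = k") (simp_all add: smooth_on_const)
  have "smooth_on S (\<lambda>x. \<chi> k j. det (\<chi> i l. if l = k then axis j 1 $ i else f x $ i $ l) / det (f x))"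
    by (intro smooth_on_vec_lambda smooth_on_divide smooth_on_det e assms)
  then show ?thesis
    by (rule smooth_on_cong) (simp add: vec_eq_iff matrix_inv_cramer assms)
qed

lemma smooth_on_continuous_on: "smooth_on S f \<Longrightarrow> continuous_on S f"
  unfolding continuous_on_eq_continuous_within
proof
  fix x assume "smooth_on S f" "x \<in> S"
  then obtain W g where W: "open W" "x \<in> W" "\<forall>k. Ck_on k W g" "\<forall>y\<in>W \<inter> S. g y = f y"
    by (rule smooth_onE)
  then have "continuous (at x within S) g"
    using Ck_on_continuous_on continuous_on_eq_continuous_at continuous_at_imp_continuous_within by blast
  then show "continuous (at x within S) f"
    by (rule continuous_transform_within_openin[where T = S and S = "W \<inter> S"])
      (use W \<open>x \<in> S\<close> in \<open>auto simp: openin_open_Int Int_commute\<close>)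
qed

section \<open>Cayley transform and symmetric involutions\<close>

lemmas matrix_mult_simps =
  bounded_bilinear.add_left[OF bounded_bilinear_matrix_mult]
  bounded_bilinear.add_right[OF bounded_bilinear_matrix_mult]
  bounded_bilinear.diff_left[OF bounded_bilinear_matrix_mult]
  bounded_bilinear.diff_right[OF bounded_bilinear_matrix_mult]
  bounded_bilinear.minus_left[OF bounded_bilinear_matrix_mult]
  bounded_bilinear.minus_right[OF bounded_bilinear_matrix_mult]
  bounded_bilinear.scaleR_left[OF bounded_bilinear_matrix_mult]
  bounded_bilinear.scaleR_right[OF bounded_bilinear_matrix_mult]
  bounded_bilinear.zero_left[OF bounded_bilinear_matrix_mult]
  bounded_bilinear.zero_right[OF bounded_bilinear_matrix_mult]
  matrix_mul_assoc matrix_mul_lid matrix_mul_rid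

lemmas matrix_vector_simps =
  bounded_bilinear.add_left[OF bounded_bilinear_matrix_vector_mult]
  bounded_bilinear.add_right[OF bounded_bilinear_matrix_vector_mult]
  bounded_bilinear.diff_left[OF bounded_bilinear_matrix_vector_mult]
  bounded_bilinear.diff_right[OF bounded_bilinear_matrix_vector_mult]
  bounded_bilinear.minus_left[OF bounded_bilinear_matrix_vector_mult]
  bounded_bilinear.minus_right[OF bounded_bilinear_matrix_vector_mult]
  bounded_bilinear.scaleR_left[OF bounded_bilinear_matrix_vector_mult]
  bounded_bilinear.scaleR_right[OF bounded_bilinear_matrix_vector_mult]
  bounded_bilinear.zero_left[OF bounded_bilinear_matrix_vector_mult]
  bounded_bilinear.zero_right[OF bounded_bilinear_matrix_vector_mult]
  matrix_vector_mul_lid matrix_vector_mul_assoc[symmetric]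

lemma transpose_add: "transpose (A + B) = transpose A + transpose (B :: real^'n^'n)"
  by (simp add: transpose_def vec_eq_iff)

lemma transpose_diff: "transpose (A - B) = transpose A - transpose (B :: real^'n^'n)"
  by (simp add: transpose_def vec_eq_iff)

lemma transpose_uminus: "transpose (- A) = - transpose (A :: real^'n^'n)"
  by (simp add: transpose_def vec_eq_iff)

lemmas transpose_simps =
  transpose_add transpose_diff transpose_uminus transpose_scalar transpose_mat
  transpose_transpose matrix_transpose_mul

lemma inner_matrix_vector: "(A *v x) \<bullet> y = x \<bullet> (transpose A *v (y :: real^'n))"
  by (metis dot_lmul_matrix transpose_matrix_vector transpose_transpose)

text \<open>Where \<open>mat 1 + Z\<close> is invertible this is (1 - Z)(1 + Z)^(-1). The form with
  a single occurrence of \<open>Z\<close> leads directly to smoothness and to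
  \<open>cayley_rel\<close>.\<close>

definition cayley :: "real^'n^'n \<Rightarrow> real^'n^'n" where
  "cayley Z = 2 *\<^sub>R matrix_inv (mat 1 + Z) - mat 1"

text \<open>The relation carries with it the invertibility of both \<open>mat 1 + A\<close> and
  \<open>mat 1 + Z\<close>, and it visibly respects transposition and conjugation; most of the
  algebra is done with it instead of with inverse matrices.\<close>

definition cayley_rel :: "real^'n^'n \<Rightarrow> real^'n^'n \<Rightarrow> bool" where
  "cayley_rel A Z \<longleftrightarrow> (mat 1 + A) ** (mat 1 + Z) = 2 *\<^sub>R mat 1"

text \<open>A one-sided inverse of a square matrix is two-sided, so the two factors of the relation
  may be exchanged.\<close>

lemma cayley_rel_sym:
  assumes "cayley_rel A Z"
  shows "cayley_rel Z A"
proof -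
  have "((1/2) *\<^sub>R (mat 1 + A)) ** (mat 1 + Z) = mat 1"
    using assms unfolding cayley_rel_def
    by (simp only: bounded_bilinear.scaleR_left[OF bounded_bilinear_matrix_mult]) simp
  then have "(mat 1 + Z) ** ((1/2) *\<^sub>R (mat 1 + A)) = mat 1"
    using matrix_left_right_inverse by blast
  then have "(1/2) *\<^sub>R ((mat 1 + Z) ** (mat 1 + A)) = mat 1"
    by (simp only: bounded_bilinear.scaleR_right[OF bounded_bilinear_matrix_mult])
  then have "2 *\<^sub>R (1/2) *\<^sub>R ((mat 1 + Z) ** (mat 1 + A)) = 2 *\<^sub>R mat 1"
    by (simp only:)
  then show ?thesis unfolding cayley_rel_def by simp
qed

lemma det_nonzeroI: "A ** B = mat 1 \<Longrightarrow> det (A :: real^'n^'n) \<noteq> 0"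
  by (metis det_I det_mul mult_zero_left zero_neq_one)

lemma cayley_rel_det:
  assumes "cayley_rel A Z"
  shows "det (mat 1 + A) \<noteq> 0"
proof (rule det_nonzeroI)
  show "(mat 1 + A) ** ((1/2) *\<^sub>R (mat 1 + Z)) = mat 1"
    using assms unfolding cayley_rel_def
    by (simp only: bounded_bilinear.scaleR_right[OF bounded_bilinear_matrix_mult]) simp
qed

lemma cayley_rel_iff: "cayley_rel A Z \<longleftrightarrow> det (mat 1 + Z) \<noteq> 0 \<and> A = cayley Z"
proof
  assume *: "cayley_rel A Z"
  then have d: "det (mat 1 + Z) \<noteq> 0"
    using cayley_rel_det cayley_rel_sym by blast
  have "mat 1 + A = (mat 1 + A) ** ((mat 1 + Z) ** matrix_inv (mat 1 + Z))"
    by (simp only: matrix_inv_right[OF d] matrix_mul_rid)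
  also have "\<dots> = (2 *\<^sub>R mat 1) ** matrix_inv (mat 1 + Z)"
    using * by (simp only: matrix_mul_assoc cayley_rel_def)
  also have "\<dots> = 2 *\<^sub>R matrix_inv (mat 1 + Z)"
    by (simp only: matrix_mult_simps)
  finally have "A = 2 *\<^sub>R matrix_inv (mat 1 + Z) - mat 1"
    by (simp add: algebra_simps)
  with d show "det (mat 1 + Z) \<noteq> 0 \<and> A = cayley Z"
    by (simp add: cayley_def)
next
  assume "det (mat 1 + Z) \<noteq> 0 \<and> A = cayley Z"
  then show "cayley_rel A Z"
    using matrix_inv_left[of "mat 1 + Z"]
    by (simp add: cayley_rel_def cayley_def bounded_bilinear.scaleR_left[OF bounded_bilinear_matrix_mult])
qed

lemma cayley_rel_cayley: "det (mat 1 + Z) \<noteq> 0 \<Longrightarrow> cayley_rel (cayley Z) Z"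
  by (simp add: cayley_rel_iff)

lemma cayley_cayley: "det (mat 1 + Z) \<noteq> 0 \<Longrightarrow> cayley (cayley Z) = Z"
  using cayley_rel_cayley cayley_rel_sym cayley_rel_iff by metis

lemma det_cayley: "det (mat 1 + Z) \<noteq> 0 \<Longrightarrow> det (mat 1 + cayley Z) \<noteq> 0"
  using cayley_rel_cayley cayley_rel_det by blast

lemma cayley_rel_unique: "cayley_rel A Z \<Longrightarrow> cayley_rel B Z \<Longrightarrow> A = B"
  by (simp add: cayley_rel_iff)

lemma cayley_rel_transpose: "cayley_rel A Z \<Longrightarrow> cayley_rel (transpose A) (transpose Z)"
  apply (drule cayley_rel_sym)
  unfolding cayley_rel_def
  by (drule arg_cong[of _ _ transpose]) (simp add: transpose_simps)

text \<open>The division-free form of Z = (1 - A)(1 + A)^(-1).\<close>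

lemma cayley_rel_mult:
  assumes "cayley_rel A Z"
  shows "Z ** (mat 1 + A) = mat 1 - A"
  using cayley_rel_sym[OF assms] unfolding cayley_rel_def
  by (simp add: matrix_mult_simps algebra_simps scaleR_2)

text \<open>Inverting (1 - A)/(1 + A) exchanges numerator and denominator, which amounts to negating
  A. The proof multiplies the relation by \<open>Z'\<close> on the right.\<close>

lemma cayley_rel_inverse:
  assumes "cayley_rel A Z" "Z ** Z' = mat 1"
  shows "cayley_rel (- A) Z'"
proof -
  have "Z ** Z' + A ** Z ** Z' + A ** Z' + Z' = (mat 1 + A) ** (mat 1 + Z) ** Z'"
    by (simp add: matrix_mult_simps algebra_simps)
  also have "\<dots> = 2 *\<^sub>R Z'"
    using assms(1) unfolding cayley_rel_def by (simp only: matrix_mult_simps)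
  finally have "mat 1 + A + A ** Z' + Z' = 2 *\<^sub>R Z'"
    using assms(2) by (simp add: matrix_mul_assoc[symmetric])
  then have "mat 1 + A + A ** Z' = Z'"
    by (simp add: scaleR_2 add.assoc)
  then show ?thesis
    unfolding cayley_rel_def by (simp add: matrix_mult_simps algebra_simps scaleR_2)
qed

lemma cayley_rel_conj:
  fixes Q Q' :: "real^'n^'n"
  assumes "cayley_rel A Z" "Q ** Q' = mat 1"
  shows "cayley_rel (Q ** A ** Q') (Q ** Z ** Q')"
proof -
  have Q: "Q' ** Q = mat 1"
    using assms(2) matrix_left_right_inverse by blast
  have e: "mat 1 + Q ** B ** Q' = Q ** (mat 1 + B) ** Q'" for B
    using assms(2) by (simp add: matrix_mult_simps)
  have "Q ** (mat 1 + A) ** Q' ** (Q ** (mat 1 + Z) ** Q')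
      = Q ** (mat 1 + A) ** (Q' ** Q) ** (mat 1 + Z) ** Q'"
    by (simp only: matrix_mul_assoc)
  also have "\<dots> = Q ** ((mat 1 + A) ** (mat 1 + Z)) ** Q'"
    by (simp only: matrix_mul_assoc Q matrix_mul_rid)
  also have "\<dots> = 2 *\<^sub>R mat 1"
    using assms unfolding cayley_rel_def by (simp add: matrix_mult_simps)
  finally show ?thesis
    unfolding cayley_rel_def e .
qed

text \<open>If Z is orthogonal, its transpose is its inverse: transposing the relation gives the
  coordinate A^T, inverting gives -A, and uniqueness equates them. In the other direction the
  invertible factor \<open>mat 1 + A\<close> is cancelled.\<close>

lemma cayley_rel_skew_iff:
  assumes "cayley_rel A Z"
  shows "transpose A = - A \<longleftrightarrow> transpose Z ** Z = mat 1"
proof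
  assume "transpose Z ** Z = mat 1"
  then have "Z ** transpose Z = mat 1"
    using matrix_left_right_inverse by blast
  then show "transpose A = - A"
    using cayley_rel_inverse[OF assms] cayley_rel_transpose[OF assms] cayley_rel_unique by blast
next
  assume sk: "transpose A = - A"
  have d: "det (mat 1 + A) \<noteq> 0"
    using cayley_rel_det[OF assms] .
  have "transpose Z ** (mat 1 - A) = mat 1 + A"
    using cayley_rel_mult[OF cayley_rel_transpose[OF assms]] sk by simp
  then have "transpose Z ** Z ** (mat 1 + A) = mat 1 + A"
    using cayley_rel_mult[OF assms] by (simp add: matrix_mul_assoc[symmetric])
  then have "transpose Z ** Z ** ((mat 1 + A) ** matrix_inv (mat 1 + A)) = (mat 1 + A) ** matrix_inv (mat 1 + A)"
    by (simp only: matrix_mul_assoc)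
  then show "transpose Z ** Z = mat 1"
    by (simp only: matrix_inv_right[OF d] matrix_mul_rid)
qed

lemma det_nonzero_iff: "det (A :: real^'n^'n) \<noteq> 0 \<longleftrightarrow> (\<forall>x. A *v x = 0 \<longrightarrow> x = 0)"
  using matrix_left_invertible_ker[of A] matrix_left_right_inverse[of _ A]
  by (metis invertible_def invertible_det_nz)

lemma inner_skew_matrix:
  assumes "transpose A = - (A :: real^'n^'n)"
  shows "x \<bullet> (A *v x) = 0"
  using inner_matrix_vector[of A x x] assms by (simp add: matrix_vector_simps inner_commute)

text \<open>A x is orthogonal to x, so x + A x = 0 forces x = 0. Hence the Cayley transform is
  defined on every skew matrix, which makes the inverse of a graph chart global.\<close>

lemma det_one_plus_skew:
  assumes "transpose A = - (A :: real^'n^'n)"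
  shows "det (mat 1 + A) \<noteq> 0"
  unfolding det_nonzero_iff
proof (intro allI impI)
  fix x assume "(mat 1 + A) *v x = 0"
  then have "x \<bullet> (x + A *v x) = 0"
    by (simp add: matrix_vector_simps)
  then show "x = 0"
    using inner_skew_matrix[OF assms] by (simp add: inner_add_right)
qed

text \<open>Symmetry of Y Z means Z^(-1) = Y Z Y. In Cayley coordinates the left side becomes -A and
  the right side Y A Y, so the condition becomes linear in A.\<close>

lemma cayley_rel_symmetric_iff:
  assumes "cayley_rel A Z" "transpose A = - A" "transpose Y = Y" "Y ** Y = mat 1"
  shows "transpose (Y ** Z) = Y ** Z \<longleftrightarrow> Y ** A = - (A ** Y)"
proof -
  have Z: "Z ** transpose Z = mat 1"
    using cayley_rel_skew_iff[OF assms(1)] assms(2) matrix_left_right_inverse by blast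
  have Zt: "cayley_rel (- A) (transpose Z)"
    using cayley_rel_inverse[OF assms(1) Z] .
  have conj: "cayley_rel (Y ** A ** Y) (Y ** Z ** Y)"
    using cayley_rel_conj[OF assms(1,4)] .
  have can: "B ** Y = C ** Y \<longleftrightarrow> B = C" for B C
    using assms(4) by (metis matrix_mul_assoc matrix_mul_rid)
  have "transpose (Y ** Z) = Y ** Z \<longleftrightarrow> transpose Z ** Y = Y ** Z"
    using assms(3) by (simp add: transpose_simps)
  also have "\<dots> \<longleftrightarrow> transpose Z = Y ** Z ** Y"
    using can[of "transpose Z" "Y ** Z ** Y"] assms(4) by (simp add: matrix_mul_assoc[symmetric])
  also have "\<dots> \<longleftrightarrow> Y ** A ** Y = - A"
    using conj Zt by (metis cayley_rel_sym cayley_rel_unique)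
  also have "\<dots> \<longleftrightarrow> Y ** A = - (A ** Y)"
    using can[of "Y ** A ** Y" "- A"] assms(4)
    by (simp add: matrix_mul_assoc[symmetric] matrix_mult_simps(5))
  finally show ?thesis .
qed

section \<open>Eigenspaces of symmetric involutions\<close>

lemma subspace_eigenspace: "subspace {x. A *v x = c *\<^sub>R (x :: real^'n)}"
  by (auto simp: subspace_def matrix_vector_simps algebra_simps)

lemma subspace_fixed: "subspace {x. A *v x = (x :: real^'n)}"
  using subspace_eigenspace[of A 1] by simp

lemma orthogonal_comp_iff: "x \<in> V\<^sup>\<bottom> \<longleftrightarrow> (\<forall>y\<in>V. y \<bullet> x = 0)"
  by (simp add: orthogonal_comp_def orthogonal_def)

text \<open>These are the projections of \<open>x\<close> to the two eigenspaces; by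
  \<open>half_sum_diff\<close> they add up to \<open>x\<close>.\<close>

lemma involution_decomp:
  fixes X :: "real^'n^'n"
  assumes "X ** X = mat 1"
  shows "X *v ((1/2) *\<^sub>R (x + X *v x)) = (1/2) *\<^sub>R (x + X *v x)"
    and "X *v ((1/2) *\<^sub>R (x - X *v x)) = - ((1/2) *\<^sub>R (x - X *v x))"
proof -
  have "X *v (X *v x) = x"
    using assms by (simp add: matrix_vector_mul_assoc)
  then show "X *v ((1/2) *\<^sub>R (x + X *v x)) = (1/2) *\<^sub>R (x + X *v x)"
    and "X *v ((1/2) *\<^sub>R (x - X *v x)) = - ((1/2) *\<^sub>R (x - X *v x))"
    by (simp_all add: matrix_vector_simps algebra_simps)
qed

lemma half_sum_diff: "(1/2) *\<^sub>R (x + y) + (1/2) *\<^sub>R (x - y) = (x :: 'a::real_vector)"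
  by (simp add: algebra_simps flip: scaleR_add_left)

lemma half_diff_diff: "(1/2) *\<^sub>R (x + y) - (1/2) *\<^sub>R (x - y) = (y :: 'a::real_vector)"
  by (simp add: algebra_simps flip: scaleR_add_left)

text \<open>Moving \<open>X\<close> across the inner product shows that eigenvectors for 1 and -1
  are orthogonal. Conversely, if x is orthogonal to all fixed vectors, its fixed component u
  satisfies u.u = u.x = 0. Orthogonal complements can thus be handled as eigenspaces
  throughout.\<close>

lemma symmetric_involution_neg:
  fixes X :: "real^'n^'n"
  assumes "transpose X = X" "X ** X = mat 1"
  shows "{x. X *v x = x}\<^sup>\<bottom> = {x. X *v x = - x}"
proof (intro set_eqI iffI)
  fix x assume "x \<in> {x. X *v x = - x}"
  then have "y \<bullet> x = - (y \<bullet> x)" if "X *v y = y" for y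
    using inner_matrix_vector[of X y x] assms that by simp
  then show "x \<in> {x. X *v x = x}\<^sup>\<bottom>"
    by (auto simp: orthogonal_comp_iff)
next
  fix x assume x: "x \<in> {x. X *v x = x}\<^sup>\<bottom>"
  let ?u = "(1/2) *\<^sub>R (x + X *v x)" and ?w = "(1/2) *\<^sub>R (x - X *v x)"
  note u = involution_decomp(1)[OF assms(2), of x] and w = involution_decomp(2)[OF assms(2), of x]
  have "?u \<bullet> ?w = - (?u \<bullet> ?w)"
    using inner_matrix_vector[of X ?u ?w] by (simp only: assms(1) u w inner_minus_right)
  then have "?u \<bullet> (?u + ?w) = ?u \<bullet> ?u"
    by (simp only: inner_add_right)
  moreover have "?u \<bullet> x = 0"
    using x u unfolding orthogonal_comp_iff mem_Collect_eq by blast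
  ultimately have "?u \<bullet> ?u = 0"
    by (simp only: half_sum_diff)
  then have "X *v x + x = 0"
    by (simp only: inner_eq_zero_iff scaleR_eq_0_iff) (simp add: add.commute)
  then show "x \<in> {x. X *v x = - x}"
    by (simp only: mem_Collect_eq eq_neg_iff_add_eq_0)
qed

lemma dim_orthogonal_comp:
  fixes V :: "'a::euclidean_space set"
  assumes "subspace V"
  shows "dim V + dim (V\<^sup>\<bottom>) = DIM('a)"
  using dim_subspace_orthogonal_to_vectors[OF assms subspace_UNIV]
  by (simp add: orthogonal_comp_def orthogonal_commute)

lemma matrix_apply: "linear f \<Longrightarrow> matrix f *v x = f (x :: real^'n)"
  by (metis matrix_vector_mul)

text \<open>The witness is the reflection 2 f - 1, with f the orthogonal projection to
  \<open>V\<close> written in an orthonormal basis.\<close>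

lemma symmetric_involution_exists:
  fixes V :: "(real^'n) set"
  assumes "subspace V"
  obtains X :: "real^'n^'n" where "transpose X = X" "X ** X = mat 1" "{x. X *v x = x} = V"
proof -
  obtain B where B: "B \<subseteq> V" "pairwise orthogonal B" "\<And>x. x \<in> B \<Longrightarrow> norm x = 1"
    "independent B" "card B = dim V" "span B = V"
    using orthonormal_basis_subspace[OF assms] by metis
  have fin: "finite B"
    using B(4) by (simp add: independent_imp_finite)
  define f where "f x = (\<Sum>b\<in>B. (x \<bullet> b) *\<^sub>R b)" for x :: "real^'n"
  have lin: "linear f"
    unfolding f_def by (intro linear_compose_sum ballI) (auto simp: linear_iff algebra_simps)
  have fV: "f x \<in> V" for x
    unfolding f_def using B(1) assms by (intro subspace_sum subspace_scale) auto
  have fb: "f b = b" if "b \<in> B" for b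
  proof -
    have "(b \<bullet> c) *\<^sub>R c = (if c = b then b else 0)" if "c \<in> B" for c
      using B(2,3) that \<open>b \<in> B\<close>
      by (auto simp: pairwise_def orthogonal_def dot_square_norm)
    then show ?thesis
      using fin \<open>b \<in> B\<close> by (simp add: f_def)
  qed
  have fid: "f x = x" if "x \<in> V" for x
    using linear_eq_on_span[OF lin linear_ident fb] that B(6) by blast
  have fsym: "f x \<bullet> y = x \<bullet> f y" for x y
    by (simp add: f_def inner_sum_left inner_sum_right inner_commute mult.commute)
  define X where "X = 2 *\<^sub>R matrix f - mat 1"
  have X: "X *v x = 2 *\<^sub>R f x - x" for x
    using matrix_apply[OF lin] by (simp add: X_def matrix_vector_simps)
  show ?thesis
  proof
    have "x \<bullet> (transpose X *v y) = x \<bullet> (X *v y)" for x y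
      by (simp only: inner_matrix_vector[symmetric] X) (simp add: inner_diff_left inner_diff_right fsym)
    then show "transpose X = X"
      unfolding matrix_eq by (metis vector_eq_ldot)
    have "f (2 *\<^sub>R f x - x) = f x" for x
      by (simp only: linear_diff[OF lin] linear_cmul[OF lin] fid[OF fV]) (simp add: scaleR_2)
    then have "X *v (X *v x) = x" for x
      unfolding X by simp
    then show "X ** X = mat 1"
      unfolding matrix_eq by (simp add: matrix_vector_mul_assoc[symmetric])
    have "X *v x = x \<longleftrightarrow> 2 *\<^sub>R f x = 2 *\<^sub>R x" for x
      unfolding X by (simp only: diff_eq_eq scaleR_2[symmetric])
    then have "X *v x = x \<longleftrightarrow> f x = x" for x
      by (simp only: scaleR_cancel_left) simp
    moreover have "f x = x \<longleftrightarrow> x \<in> V" for x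
      using fid[of x] fV[of x] by auto
    ultimately show "{x. X *v x = x} = V"
      by simp
  qed
qed

text \<open>The fixed space determines its orthogonal complement, which is the other eigenspace, and
  the two together span.\<close>

lemma symmetric_involution_unique:
  fixes X Y :: "real^'n^'n"
  assumes "transpose X = X" "X ** X = mat 1" "transpose Y = Y" "Y ** Y = mat 1"
    and eq: "{x. X *v x = x} = {x. Y *v x = x}"
  shows "X = Y"
  unfolding matrix_eq
proof
  fix x
  let ?u = "(1/2) *\<^sub>R (x + X *v x)" and ?w = "(1/2) *\<^sub>R (x - X *v x)"
  note u = involution_decomp(1)[OF assms(2), of x] and w = involution_decomp(2)[OF assms(2), of x]
  have "{x. X *v x = - x} = {x. Y *v x = - x}"
    by (simp only: symmetric_involution_neg[OF assms(1,2), symmetric]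
        symmetric_involution_neg[OF assms(3,4), symmetric] eq)
  then have "Y *v ?w = - ?w" using w by blast
  moreover have "Y *v ?u = ?u" using u eq by blast
  ultimately have "X *v (?u + ?w) = Y *v (?u + ?w)"
    using u w by (simp only: matrix_vector_simps(2))
  then show "X *v x = Y *v x"
    by (simp only: half_sum_diff)
qed

text \<open>An isometry between the fixed spaces and one between their complements are glued along
  the eigenspace decomposition; Pythagoras makes the result orthogonal. It serves to compare
  dimensions of tangent models and to compute determinants.\<close>

lemma symmetric_involutions_conjugate:
  fixes X Y :: "real^'n^'n"
  assumes X: "transpose X = X" "X ** X = mat 1" and Y: "transpose Y = Y" "Y ** Y = mat 1"
    and "dim {x. X *v x = x} = dim {x. Y *v x = x}"
  obtains Q where "orthogonal_matrix Q" "Y ** Q = Q ** X"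
proof -
  have "dim ({x. X *v x = x}\<^sup>\<bottom>) = dim ({x. Y *v x = x}\<^sup>\<bottom>)"
    using assms(5) dim_orthogonal_comp[OF subspace_fixed, of X] dim_orthogonal_comp[OF subspace_fixed, of Y]
    by simp
  then have d: "dim {x. X *v x = - x} = dim {x. Y *v x = - x}"
    by (simp only: symmetric_involution_neg[OF X] symmetric_involution_neg[OF Y])
  have sub: "subspace {x. A *v x = - x}" for A :: "real^'n^'n"
    using subspace_eigenspace[of A "-1"] by simp
  obtain f where f: "linear f" "f ` {x. X *v x = x} = {x. Y *v x = x}"
    "\<And>x. x \<in> {x. X *v x = x} \<Longrightarrow> norm (f x) = norm x"
    by (rule isometry_subspaces[OF subspace_fixed subspace_fixed assms(5)]) blast
  obtain g where g: "linear g" "g ` {x. X *v x = - x} = {x. Y *v x = - x}"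
    "\<And>x. x \<in> {x. X *v x = - x} \<Longrightarrow> norm (g x) = norm x"
    by (rule isometry_subspaces[OF sub sub d]) blast
  define u w where "u x = (1/2) *\<^sub>R (x + X *v x)" and "w x = (1/2) *\<^sub>R (x - X *v x)" for x
  have lin: "linear u" "linear w"
    by (auto simp: u_def w_def linear_iff matrix_vector_simps algebra_simps)
  have uw: "X *v u x = u x" "X *v w x = - w x" "u x + w x = x" "u x - w x = X *v x" for x
    using involution_decomp[OF X(2)] half_sum_diff half_diff_diff by (auto simp: u_def w_def)
  have fu: "Y *v f (u x) = f (u x)" and gw: "Y *v g (w x) = - g (w x)" for x
    using f(2) g(2) uw(1,2) by blast+
  have orth: "a \<bullet> b = 0" if "transpose A = A" "A *v a = a" "A *v b = - b" for A and a b :: "real^'n"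
    using inner_matrix_vector[of A a b] that by simp
  define h where "h x = f (u x) + g (w x)" for x
  have h: "linear h"
    unfolding h_def
    by (intro linear_compose_add linear_compose[OF lin(1) f(1), unfolded o_def]
        linear_compose[OF lin(2) g(1), unfolded o_def])
  have "norm (h x) = norm x" for x
  proof -
    have "(norm (h x))\<^sup>2 = (norm (f (u x)))\<^sup>2 + (norm (g (w x)))\<^sup>2"
      unfolding h_def using orth[OF Y(1) fu gw]
      by (intro norm_add_Pythagorean) (simp add: orthogonal_def)
    also have "\<dots> = (norm (u x))\<^sup>2 + (norm (w x))\<^sup>2"
      using f(3) g(3) uw(1,2) by simp
    also have "\<dots> = (norm (u x + w x))\<^sup>2"
      using orth[OF X(1) uw(1,2)] by (intro norm_add_Pythagorean[symmetric]) (simp add: orthogonal_def)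
    finally show ?thesis
      by (simp add: uw(3))
  qed
  then have "orthogonal_transformation h"
    using h by (simp add: orthogonal_transformation)
  then have Q: "orthogonal_matrix (matrix h)"
    by (simp add: orthogonal_transformation_matrix)
  have "Y *v h x = h (X *v x)" for x
  proof -
    have "u (X *v x) = u x" "w (X *v x) = - w x"
      using X(2) by (simp_all add: u_def w_def matrix_vector_mul_assoc algebra_simps)
    then have "h (X *v x) = f (u x) - g (w x)"
      by (simp add: h_def linear_neg[OF g(1)])
    then show ?thesis
      unfolding h_def by (simp add: matrix_vector_simps fu gw)
  qed
  then have "Y ** matrix h = matrix h ** X"
    unfolding matrix_eq by (simp add: matrix_vector_mul_assoc[symmetric] matrix_apply[OF h])
  with Q show ?thesis by (rule that)
qed

section \<open>Slice charts of the orthogonal group\<close>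

lemma orthogonal_matrix_mult_transpose: "orthogonal_matrix Q \<Longrightarrow> Q ** transpose Q = mat 1"
  by (simp add: orthogonal_matrix_def)

lemma orthogonal_matrix_transpose_mult: "orthogonal_matrix Q \<Longrightarrow> transpose Q ** Q = mat 1"
  by (simp add: orthogonal_matrix_def)

lemma inj_matrix: "det A \<noteq> 0 \<Longrightarrow> inj ((*v) (A :: real^'n^'n))"
  by (metis det_nonzero_iff inj_matrix_vector_mult invertible_det_nz)

text \<open>The equation expresses X = M Y M^(-1) without an inverse. Later \<open>M\<close> is
  \<open>mat 1 + A\<close> for a Cayley coordinate \<open>A\<close>.\<close>

lemma fixed_intertwined:
  fixes M X Y :: "real^'n^'n"
  assumes "det M \<noteq> 0" "X ** M = M ** Y"
  shows "{x. X *v x = x} = (*v) M ` {x. Y *v x = x}"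
proof (intro set_eqI iffI)
  have XM: "X *v (M *v x) = M *v (Y *v x)" for x
    using assms(2) by (simp add: matrix_vector_mul_assoc)
  fix x
  show "x \<in> {x. X *v x = x}" if "x \<in> (*v) M ` {x. Y *v x = x}"
    using that XM by auto
  assume x: "x \<in> {x. X *v x = x}"
  define y where "y = matrix_inv M *v x"
  have My: "M *v y = x"
    using matrix_inv_right[OF assms(1)] by (simp add: y_def matrix_vector_mul_assoc)
  then have "M *v (Y *v y) = M *v y"
    using XM[of y] x by simp
  then have "Y *v y = y"
    using injD[OF inj_matrix[OF assms(1)]] by blast
  with My show "x \<in> (*v) M ` {x. Y *v x = x}"
    by auto
qed

lemma dim_fixed_intertwined:
  fixes M X Y :: "real^'n^'n"
  assumes "det M \<noteq> 0" "X ** M = M ** Y"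
  shows "dim {x. X *v x = x} = dim {x. Y *v x = x}"
  unfolding fixed_intertwined[OF assms]
  by (rule dim_image_eq) (use inj_matrix[OF assms(1)] in \<open>auto intro: inj_on_subset\<close>)

lemma sym_orthogonal_iff:
  "X \<in> sym_orthogonal p m \<longleftrightarrow> transpose X = X \<and> X ** X = mat 1 \<and>
     dim {x. X *v x = x} = p \<and> dim {x. X *v x = - x} = m"
  by (auto simp: sym_orthogonal_def orthogonal_matrix)

lemma dim_symmetric_involution:
  fixes X :: "real^'n^'n"
  assumes "transpose X = X" "X ** X = mat 1"
  shows "dim {x. X *v x = x} + dim {x. X *v x = - x} = CARD('n)"
  using dim_orthogonal_comp[OF subspace_fixed, of X] symmetric_involution_neg[OF assms] by simp

lemma sym_orthogonal_iff_dim: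
  fixes X :: "real^'n^'n"
  assumes "k + m = CARD('n)"
  shows "X \<in> sym_orthogonal k m \<longleftrightarrow> transpose X = X \<and> X ** X = mat 1 \<and> dim {x. X *v x = x} = k"
  using dim_symmetric_involution[of X] assms unfolding sym_orthogonal_iff by auto

lemma sym_orthogonal_orthogonal: "X \<in> sym_orthogonal k m \<Longrightarrow> orthogonal_matrix X"
  by (simp add: sym_orthogonal_def)

text \<open>Z (1 + A) = 1 - A by \<open>cayley_rel_mult\<close>, and moving Y across A by
  anticommutation turns the minus sign back into a plus.\<close>

lemma cayley_involution_intertwined:
  assumes "cayley_rel A Z" "Y ** A = - (A ** Y)"
  shows "(Y ** Z) ** (mat 1 + A) = (mat 1 + A) ** Y"
proof -
  have "(Y ** Z) ** (mat 1 + A) = Y ** (mat 1 - A)"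
    using cayley_rel_mult[OF assms(1)] by (simp add: matrix_mul_assoc[symmetric])
  then show ?thesis
    using assms(2) by (simp add: matrix_mult_simps)
qed

text \<open>In Cayley coordinates around \<open>Y\<close> the symmetric involutions form a linear subspace.\<close>

lemma cayley_involution:
  fixes Y :: "real^'n^'n"
  assumes Y: "transpose Y = Y" "Y ** Y = mat 1"
    and A: "cayley_rel A Z" "transpose A = - A" "Y ** A = - (A ** Y)"
  shows "transpose (Y ** Z) = Y ** Z" "(Y ** Z) ** (Y ** Z) = mat 1"
    "dim {x. (Y ** Z) *v x = x} = dim {x. Y *v x = x}"
proof -
  show sym: "transpose (Y ** Z) = Y ** Z"
    using cayley_rel_symmetric_iff[OF A(1,2) Y] A(3) by simp
  have "transpose (Y ** Z) ** (Y ** Z) = transpose Z ** (Y ** Y) ** Z"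
    using Y(1) by (simp add: transpose_simps matrix_mul_assoc)
  also have "\<dots> = mat 1"
    using cayley_rel_skew_iff[OF A(1)] A(2) Y(2) by simp
  finally show "(Y ** Z) ** (Y ** Z) = mat 1"
    unfolding sym .
  show "dim {x. (Y ** Z) *v x = x} = dim {x. Y *v x = x}"
    by (rule dim_fixed_intertwined[OF cayley_rel_det[OF A(1)] cayley_involution_intertwined[OF A(1,3)]])
qed

text \<open>The converse of \<open>cayley_involution\<close>, with Z = Y X, so that Y Z = X. A
  product of two symmetric involutions is orthogonal, which gives skewness; symmetry of X gives
  anticommutation.\<close>

lemma cayley_of_involutions:
  fixes X Y :: "real^'n^'n"
  assumes Y: "transpose Y = Y" "Y ** Y = mat 1" and X: "transpose X = X" "X ** X = mat 1"
    and "cayley_rel A (Y ** X)"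
  shows "transpose A = - A" "Y ** A = - (A ** Y)"
proof -
  have "transpose (Y ** X) ** (Y ** X) = X ** (Y ** Y) ** X"
    by (simp only: transpose_simps X(1) Y(1) matrix_mul_assoc)
  also have "\<dots> = mat 1"
    by (simp only: X Y matrix_mul_rid)
  finally show sk: "transpose A = - A"
    using cayley_rel_skew_iff[OF assms(5)] by simp
  have "Y ** (Y ** X) = X" using Y by (simp add: matrix_mul_assoc)
  then show "Y ** A = - (A ** Y)"
    using cayley_rel_symmetric_iff[OF assms(5) sk Y] X by simp
qed

text \<open>For orthogonal \<open>Q\<close> the centre \<open>Q\<close> has the coordinate 0, and
  the inverse sends \<open>A\<close> to \<open>Q ** cayley A\<close>. The domain is open in the
  space of all matrices, so this is an ambient chart that is still to be sliced.\<close>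

definition cayley_chart :: "real^'n^'n \<Rightarrow> (real^'n^'n, real^'n^'n) chart" where
  "cayley_chart Q = ({H. det (mat 1 + transpose Q ** H) \<noteq> 0}, \<lambda>H. cayley (transpose Q ** H))"

lemma smooth_on_cayley:
  fixes f :: "'a::euclidean_space \<Rightarrow> real^'n^'n"
  assumes "smooth_on S f" "\<And>x. x \<in> S \<Longrightarrow> det (mat 1 + f x) \<noteq> 0"
  shows "smooth_on S (\<lambda>x. cayley (f x))"
  unfolding cayley_def
  by (rule smooth_on_diff[OF smooth_on_scaleR_left[OF smooth_on_matrix_inv] smooth_on_const])
    (rule smooth_on_add[OF smooth_on_const assms(1)], rule assms(2))

lemma smooth_on_matrix_mult_const:
  fixes f :: "'a::euclidean_space \<Rightarrow> real^'n^'n"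
  assumes "smooth_on S f"
  shows "smooth_on S (\<lambda>x. A ** f x)" "smooth_on S (\<lambda>x. f x ** A)"
  by (rule smooth_on_matrix_mult[OF smooth_on_const assms])
    (rule smooth_on_matrix_mult[OF assms smooth_on_const])

lemma open_det_nonzero:
  fixes f :: "'a::euclidean_space \<Rightarrow> real^'n^'n"
  assumes "smooth_on S f" "open S"
  shows "open {x\<in>S. det (f x) \<noteq> 0}"
proof -
  have "{x\<in>S. det (f x) \<noteq> 0} = S \<inter> (\<lambda>x. det (f x)) -` (- {0})"
    by auto
  then show ?thesis
    using continuous_open_preimage[OF smooth_on_continuous_on[OF smooth_on_det[OF assms(1)]] assms(2)
        open_Compl[OF closed_singleton[of 0]]]
    by simp
qed

lemma open_cayley_domain: "open {A :: real^'n^'n. det (mat 1 + A) \<noteq> 0}"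
  using open_det_nonzero[OF smooth_on_add[OF smooth_on_const smooth_on_id] open_UNIV, of "mat 1"] by simp

lemma cayley_chart_image:
  assumes "orthogonal_matrix Q"
  shows "snd (cayley_chart Q) ` fst (cayley_chart Q) = {A. det (mat 1 + A) \<noteq> 0}"
proof (intro set_eqI iffI)
  fix A :: "real^'a^'a" assume "A \<in> {A. det (mat 1 + A) \<noteq> 0}"
  then have d: "det (mat 1 + A) \<noteq> 0" by simp
  have "transpose Q ** (Q ** cayley A) = cayley A"
    using orthogonal_matrix_transpose_mult[OF assms] by (simp add: matrix_mul_assoc)
  then show "A \<in> snd (cayley_chart Q) ` fst (cayley_chart Q)"
    using det_cayley[OF d] cayley_cayley[OF d]
    by (intro image_eqI[of _ _ "Q ** cayley A"]) (simp_all add: cayley_chart_def)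
qed (auto simp: cayley_chart_def det_cayley)

lemma cayley_chart_in_euclidean_atlas:
  assumes "orthogonal_matrix Q"
  shows "cayley_chart Q \<in> euclidean_atlas"
proof -
  let ?U = "fst (cayley_chart Q)" and ?\<phi> = "snd (cayley_chart Q)"
  have lin: "smooth_on S (\<lambda>H. mat 1 + transpose Q ** H)" for S
    by (rule smooth_on_add[OF smooth_on_const smooth_on_matrix_mult_const(1)[OF smooth_on_id]])
  have op: "open ?U"
    using open_det_nonzero[OF lin[of UNIV] open_UNIV] by (simp add: cayley_chart_def)
  have inv: "Q ** cayley (?\<phi> H) = H" if "H \<in> ?U" for H
    using that orthogonal_matrix_mult_transpose[OF assms]
    by (simp add: cayley_chart_def cayley_cayley matrix_mul_assoc)
  have inj: "inj_on ?\<phi> ?U"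
    by (rule inj_on_inverseI[of _ "\<lambda>A. Q ** cayley A"]) (rule inv)
  have "open (?\<phi> ` ?U)"
    unfolding cayley_chart_image[OF assms] by (rule open_cayley_domain)
  moreover have "smooth_on ?U ?\<phi>"
    unfolding cayley_chart_def snd_conv
    by (rule smooth_on_cayley[OF smooth_on_matrix_mult_const(1)[OF smooth_on_id]]) simp
  moreover have "smooth_on (?\<phi> ` ?U) (\<lambda>A. Q ** cayley A)"
    unfolding cayley_chart_image[OF assms]
    by (rule smooth_on_matrix_mult_const(1)[OF smooth_on_cayley[OF smooth_on_id]]) simp
  then have "smooth_on (?\<phi> ` ?U) (inv_into ?U ?\<phi>)"
    by (rule smooth_on_cong) (auto simp: inv inv_into_f_f[OF inj])
  ultimately show ?thesis
    unfolding euclidean_atlas_def using op inj by (simp add: case_prod_beta)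
qed

text \<open>A neighbourhood of 0 in a subspace spans it. Model space and dimension of a chart are
  read off from the span of its image, and the images of Cayley charts are of this shape.\<close>

lemma span_open_Int_subspace:
  fixes K :: "'a::euclidean_space set"
  assumes "open W" "0 \<in> W" "subspace K"
  shows "span (W \<inter> K) = K" "dim (W \<inter> K) = dim K"
proof -
  have "openin (top_of_set K) (W \<inter> K)"
    using assms(1) by (metis Int_commute openin_open_Int)
  then show d: "dim (W \<inter> K) = dim K"
    using assms subspace_0[OF assms(3)] by (intro dim_openin) auto
  show "span (W \<inter> K) = K"
    by (rule subspace_dim_equal[OF subspace_span assms(3) span_minimal[OF Int_lower2 assms(3)]])
      (simp add: d dim_span)
qed

lemma orthogonal_matrix_left_translate_iff:
  fixes Q :: "real^'n^'n"
  assumes "orthogonal_matrix Q"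
  shows "orthogonal_matrix H \<longleftrightarrow> transpose (transpose Q ** H) ** (transpose Q ** H) = mat 1"
proof -
  have "transpose (transpose Q ** H) ** (transpose Q ** H) = transpose H ** (Q ** transpose Q) ** H"
    by (simp add: transpose_simps matrix_mul_assoc)
  then show ?thesis
    using orthogonal_matrix_mult_transpose[OF assms] by (simp add: orthogonal_matrix)
qed

abbreviation skew_matrices :: "(real^'n^'n) set" where
  "skew_matrices \<equiv> {A. transpose A = - A}"

lemma transpose_zero: "transpose (0 :: real^'n^'n) = 0"
  by (simp add: transpose_def vec_eq_iff)

lemma subspace_skew_matrices: "subspace skew_matrices"
  unfolding subspace_def by (simp add: transpose_zero transpose_add transpose_scalar)

lemma cayley_chart_orthogonal_group:
  assumes "orthogonal_matrix Q"
  shows "snd (cayley_chart Q) ` (fst (cayley_chart Q) \<inter> orthogonal_group)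
    = snd (cayley_chart Q) ` fst (cayley_chart Q) \<inter> skew_matrices"
proof -
  have "snd (cayley_chart Q) H \<in> skew_matrices \<longleftrightarrow> H \<in> orthogonal_group"
    if "H \<in> fst (cayley_chart Q)" for H
    using that cayley_rel_skew_iff[OF cayley_rel_cayley, of "transpose Q ** H"] orthogonal_matrix_left_translate_iff[OF assms, of H]
    by (simp add: cayley_chart_def orthogonal_group_def)
  then show ?thesis by blast
qed

lemma cayley_chart_in_orthogonal_group_atlas:
  assumes "orthogonal_matrix Q"
  shows "(fst (cayley_chart Q) \<inter> orthogonal_group, snd (cayley_chart Q)) \<in> orthogonal_group_atlas"
proof -
  have "span (snd (cayley_chart Q) ` fst (cayley_chart Q)) = UNIV"
    unfolding cayley_chart_image[OF assms]
    using span_open_Int_subspace(1)[OF open_cayley_domain _ subspace_UNIV] by simp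
  then show ?thesis
    unfolding orthogonal_group_atlas_def slice_atlas_def
    using cayley_chart_in_euclidean_atlas[OF assms] cayley_chart_orthogonal_group[OF assms]
      subspace_skew_matrices
    by (intro CollectI exI[of _ "fst (cayley_chart Q)"] exI[of _ "snd (cayley_chart Q)"]
        exI[of _ skew_matrices] conjI) simp_all
qed

text \<open>In blocks with respect to the eigenspaces of \<open>Y\<close> these are the skew
  matrices with vanishing diagonal blocks. Up to left multiplication by \<open>Y\<close> they form
  the tangent space at \<open>Y\<close> of the symmetric involutions.\<close>

definition anticommuting_skew :: "real^'n^'n \<Rightarrow> (real^'n^'n) set" where
  "anticommuting_skew Y = {A. transpose A = - A \<and> Y ** A = - (A ** Y)}"

lemma subspace_anticommuting_skew: "subspace (anticommuting_skew Y)"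
  unfolding subspace_def anticommuting_skew_def
  by (simp add: transpose_zero transpose_add transpose_scalar matrix_mult_simps)

text \<open>Conjugation by an orthogonal \<open>Q\<close> that carries \<open>X\<close> to
  \<open>Y\<close> maps one space injectively into the other. Since \<open>submanifold\<close> asks
  for one dimension at all points, comparing the dimensions suffices; exchanging \<open>X\<close>
  and \<open>Y\<close> gives equality.\<close>

lemma dim_anticommuting_skew_le:
  fixes X Y :: "real^'n^'n"
  assumes "transpose X = X" "X ** X = mat 1" "transpose Y = Y" "Y ** Y = mat 1"
    and "dim {x. X *v x = x} = dim {x. Y *v x = x}"
  shows "dim (anticommuting_skew X) \<le> dim (anticommuting_skew Y)"
proof -
  obtain Q where Q: "orthogonal_matrix Q" "Y ** Q = Q ** X"
    using symmetric_involutions_conjugate[OF assms] .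
  note QQ = orthogonal_matrix_transpose_mult[OF Q(1)] orthogonal_matrix_mult_transpose[OF Q(1)]
  have QY: "transpose Q ** Y = X ** transpose Q"
    using arg_cong[OF Q(2), of transpose] assms(1,3) by (simp add: transpose_simps)
  let ?f = "\<lambda>A. Q ** A ** transpose Q"
  have lin: "linear ?f"
    by (auto simp: linear_iff matrix_mult_simps)
  have "transpose Q ** ?f A ** Q = (transpose Q ** Q) ** A ** (transpose Q ** Q)" for A
    by (simp only: matrix_mul_assoc)
  then have left_inv: "transpose Q ** ?f A ** Q = A" for A
    using QQ by simp
  have "?f A \<in> anticommuting_skew Y" if "A \<in> anticommuting_skew X" for A
  proof -
    have A: "transpose A = - A" "X ** A = - (A ** X)"
      using that by (auto simp: anticommuting_skew_def)
    have "Y ** ?f A = (Q ** X) ** A ** transpose Q"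
      by (simp only: matrix_mul_assoc Q(2))
    also have "\<dots> = Q ** (X ** A) ** transpose Q"
      by (simp only: matrix_mul_assoc)
    also have "\<dots> = - (Q ** A ** (X ** transpose Q))"
      by (simp only: A(2) matrix_mult_simps)
    also have "\<dots> = - (?f A ** Y)"
      by (simp only: QY[symmetric] matrix_mul_assoc)
    finally show ?thesis
      using A(1) by (simp add: anticommuting_skew_def transpose_simps matrix_mult_simps)
  qed
  then have "dim (?f ` anticommuting_skew X) \<le> dim (anticommuting_skew Y)"
    by (intro dim_subset) auto
  moreover have "dim (?f ` anticommuting_skew X) = dim (anticommuting_skew X)"
    by (rule dim_image_eq[OF lin]) (rule inj_on_inverseI[of _ "\<lambda>B. transpose Q ** B ** Q"], rule left_inv)
  ultimately show ?thesis by simp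
qed

lemma dim_anticommuting_skew_eq:
  fixes X Y :: "real^'n^'n"
  assumes "X \<in> sym_orthogonal k m" "Y \<in> sym_orthogonal k m"
  shows "dim (anticommuting_skew X) = dim (anticommuting_skew Y)"
  using assms unfolding sym_orthogonal_iff by (intro antisym dim_anticommuting_skew_le) auto

text \<open>With Z = (G X)^T H one has H = G (X Z). Cancelling G reduces membership to X Z being a
  symmetric involution with fixed space of dimension k, which is decided by the Cayley coordinate of
  Z.\<close>

lemma cayley_chart_sym_orthogonal:
  fixes G X :: "real^'n^'n"
  assumes G: "orthogonal_matrix G" and X: "X \<in> sym_orthogonal k m" and km: "k + m = CARD('n)"
    and H: "H \<in> fst (cayley_chart (G ** X))"
  shows "H \<in> left_translation G ` sym_orthogonal k m \<longleftrightarrow>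
    snd (cayley_chart (G ** X)) H \<in> anticommuting_skew X"
proof -
  define Z where "Z = transpose (G ** X) ** H"
  define A where "A = cayley Z"
  have Q: "orthogonal_matrix (G ** X)"
    using G sym_orthogonal_orthogonal[OF X] by (rule orthogonal_matrix_mul)
  have A: "cayley_rel A Z"
    using H unfolding A_def by (intro cayley_rel_cayley) (simp add: Z_def cayley_chart_def)
  have Xs: "transpose X = X" "X ** X = mat 1" "dim {x. X *v x = x} = k"
    using X by (auto simp: sym_orthogonal_iff)
  have HZ: "H = G ** (X ** Z)"
    using orthogonal_matrix_mult_transpose[OF Q] by (simp add: Z_def matrix_mul_assoc)
  have "H \<in> left_translation G ` sym_orthogonal k m \<longleftrightarrow> X ** Z \<in> sym_orthogonal k m"
  proof
    assume "H \<in> left_translation G ` sym_orthogonal k m"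
    then obtain X' where X': "X' \<in> sym_orthogonal k m" "G ** X' = G ** (X ** Z)"
      using HZ by (auto simp: left_translation_def)
    then have "(transpose G ** G) ** X' = (transpose G ** G) ** (X ** Z)"
      by (simp only: matrix_mul_assoc[symmetric])
    then show "X ** Z \<in> sym_orthogonal k m"
      using X'(1) orthogonal_matrix_transpose_mult[OF G] by simp
  qed (use HZ in \<open>auto simp: left_translation_def\<close>)
  also have "\<dots> \<longleftrightarrow> A \<in> anticommuting_skew X"
  proof
    assume "X ** Z \<in> sym_orthogonal k m"
    then have XZ: "transpose (X ** Z) = X ** Z" "(X ** Z) ** (X ** Z) = mat 1"
      by (auto simp: sym_orthogonal_iff)
    have "X ** (X ** Z) = Z"
      using Xs(2) by (simp add: matrix_mul_assoc)
    then have "cayley_rel A (X ** (X ** Z))"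
      using A by (simp only:)
    from cayley_of_involutions[OF Xs(1,2) XZ this] show "A \<in> anticommuting_skew X"
      unfolding anticommuting_skew_def by blast
  next
    assume "A \<in> anticommuting_skew X"
    then show "X ** Z \<in> sym_orthogonal k m"
      using cayley_involution[OF Xs(1,2) A] Xs(3)
      by (simp add: sym_orthogonal_iff_dim[OF km] anticommuting_skew_def)
  qed
  finally show ?thesis
    by (simp add: A_def Z_def cayley_chart_def)
qed

lemma left_translation_sym_orthogonal_subset:
  "orthogonal_matrix G \<Longrightarrow> left_translation G ` sym_orthogonal k m \<subseteq> orthogonal_group"
  by (auto simp: left_translation_def orthogonal_group_def
      intro: orthogonal_matrix_mul sym_orthogonal_orthogonal)

lemma submanifold_left_translation_sym_orthogonal:
  fixes G :: "real^'n^'n"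
  assumes G: "orthogonal_matrix G" and km: "k + m = CARD('n)"
  shows "submanifold orthogonal_group_atlas (left_translation G ` sym_orthogonal k m)"
    (is "submanifold _ ?S")
\<comment> \<open>In the nonempty case a member is picked whose space of anticommuting skew matrices
  names the single dimension that \<open>submanifold\<close> asks for.\<close>
proof (cases "?S = {}")
  case True
  then show ?thesis by (simp add: submanifold_def)
next
  case False
  then obtain X0 :: "real^'n^'n" where X0: "X0 \<in> sym_orthogonal k m" by auto
  have "\<exists>(U, \<phi>)\<in>slice_atlas orthogonal_group_atlas ?S. H \<in> U \<and> dim (\<phi> ` U) = dim (anticommuting_skew X0)"
    if HS: "H \<in> ?S" for H
  proof -
    obtain X where X: "X \<in> sym_orthogonal k m" and H: "H = G ** X"
      using HS by (auto simp: left_translation_def)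
    have Q: "orthogonal_matrix (G ** X)"
      using G sym_orthogonal_orthogonal[OF X] by (rule orthogonal_matrix_mul)
    let ?U = "fst (cayley_chart (G ** X))" and ?\<phi> = "snd (cayley_chart (G ** X))"
    let ?D = "{A :: real^'n^'n. det (mat 1 + A) \<noteq> 0}"
    have im: "?\<phi> ` (?U \<inter> orthogonal_group) = ?D \<inter> skew_matrices"
      by (simp only: cayley_chart_orthogonal_group[OF Q] cayley_chart_image[OF Q])
    have sub: "anticommuting_skew X \<subseteq> skew_matrices"
      by (auto simp: anticommuting_skew_def)
    \<comment> \<open>A second slicing: inside the skew model space of the orthogonal group, the
      subset is cut out by the anticommuting matrices.\<close>
    have S: "?\<phi> ` (?U \<inter> orthogonal_group \<inter> ?S) = ?\<phi> ` (?U \<inter> orthogonal_group) \<inter> anticommuting_skew X"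
      using cayley_chart_sym_orthogonal[OF G X km] by blast
    then have S': "?\<phi> ` (?U \<inter> orthogonal_group \<inter> ?S) = ?D \<inter> anticommuting_skew X"
      unfolding im using sub by blast
    have "span (?\<phi> ` (?U \<inter> orthogonal_group)) = skew_matrices"
      unfolding im by (rule span_open_Int_subspace(1)[OF open_cayley_domain _ subspace_skew_matrices]) simp
    then have "(?U \<inter> orthogonal_group \<inter> ?S, ?\<phi>) \<in> slice_atlas orthogonal_group_atlas ?S"
      unfolding slice_atlas_def mem_Collect_eq
      by (intro exI[of _ "?U \<inter> orthogonal_group"] exI[of _ ?\<phi>] conjI exI[of _ "anticommuting_skew X"]
          refl cayley_chart_in_orthogonal_group_atlas[OF Q] S subspace_anticommuting_skew)
        (simp only: sub)
    moreover have "H \<in> ?U \<inter> orthogonal_group \<inter> ?S"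
    proof -
      \<comment> \<open>At the centre of the chart Z = 1, so \<open>mat 1 + Z\<close> is twice the
        identity and hence invertible.\<close>
      have "mat 1 + transpose (G ** X) ** (G ** X) = 2 *\<^sub>R mat 1"
        by (simp only: orthogonal_matrix_transpose_mult[OF Q] scaleR_2)
      then have "(mat 1 + transpose (G ** X) ** (G ** X)) ** ((1/2) *\<^sub>R mat 1) = mat 1"
        by (simp only: matrix_mult_simps) simp
      from det_nonzeroI[OF this] show ?thesis
        using HS Q by (simp add: H cayley_chart_def orthogonal_group_def)
    qed
    moreover have "dim (?\<phi> ` (?U \<inter> orthogonal_group \<inter> ?S)) = dim (anticommuting_skew X0)"
      unfolding S' dim_anticommuting_skew_eq[OF X0 X]
      by (rule span_open_Int_subspace(2)[OF open_cayley_domain _ subspace_anticommuting_skew]) simp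
    ultimately show ?thesis
      by (intro bexI[of _ "(?U \<inter> orthogonal_group \<inter> ?S, ?\<phi>)"] case_prodI conjI)
  qed
  then show ?thesis
    unfolding submanifold_def by (intro exI[of _ "dim (anticommuting_skew X0)"] ballI)
qed

section \<open>Graph charts of the Grassmannian\<close>

lemma eq_minus_self_iff: "a = - a \<longleftrightarrow> a = (0 :: 'a::real_vector)"
  using scaleR_2[of a] by (auto simp: eq_neg_iff_add_eq_0)

lemma sum_diff_eqD:
  fixes a b c d :: "'a::real_vector"
  assumes "a + b = c + d" "a - b = c - d"
  shows "a = c"
proof -
  have "2 *\<^sub>R a = (a + b) + (a - b)" "2 *\<^sub>R c = (c + d) + (c - d)"
    by (simp_all add: scaleR_2)
  then have "2 *\<^sub>R a = 2 *\<^sub>R c"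
    by (simp only: assms)
  then show ?thesis
    by (simp only: scaleR_cancel_left) simp
qed

definition graph_matrices :: "(real^'n) set \<Rightarrow> (real^'n^'n) set" where
  "graph_matrices P = {T. (\<forall>x\<in>P\<^sup>\<bottom>. T *v x = 0) \<and> (\<forall>x. T *v x \<in> P\<^sup>\<bottom>)}"

text \<open>Vanishing on ker(Y + 1) and taking values there become equations between matrices, which
  can be transposed and combined with anticommutation.\<close>

lemma graph_matrices_iff:
  fixes Y :: "real^'n^'n"
  assumes Y: "transpose Y = Y" "Y ** Y = mat 1"
  shows "T \<in> graph_matrices {x. Y *v x = x} \<longleftrightarrow> T ** Y = T \<and> Y ** T = - T"
proof (intro iffI conjI)
  assume "T \<in> graph_matrices {x. Y *v x = x}"
  then have T: "\<And>x. Y *v x = - x \<Longrightarrow> T *v x = 0" "\<And>x. Y *v (T *v x) = - (T *v x)"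
    unfolding graph_matrices_def symmetric_involution_neg[OF Y] by auto
  show "T ** Y = T"
    unfolding matrix_eq
  proof
    fix x
    have "T *v ((1/2) *\<^sub>R (x - Y *v x)) = 0"
      by (rule T(1)) (rule involution_decomp(2)[OF Y(2)])
    then show "(T ** Y) *v x = T *v x"
      by (simp add: matrix_vector_simps)
  qed
  show "Y ** T = - T"
    unfolding matrix_eq using T(2) by (simp add: matrix_vector_simps)
next
  assume T: "T ** Y = T \<and> Y ** T = - T"
  have "T *v x = 0" if "Y *v x = - x" for x
  proof -
    have "T *v x = T *v (Y *v x)"
      using T by (simp add: matrix_vector_mul_assoc)
    then have "T *v x = - (T *v x)"
      by (simp only: that matrix_vector_simps)
    then show ?thesis by (simp only: eq_minus_self_iff)
  qed
  moreover have "Y *v (T *v x) = - (T *v x)" for x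
  proof -
    have "(Y ** T) *v x = (- T) *v x"
      using T by simp
    then show ?thesis by (simp only: matrix_vector_simps)
  qed
  ultimately show "T \<in> graph_matrices {x. Y *v x = x}"
    unfolding graph_matrices_def symmetric_involution_neg[OF Y] by auto
qed

text \<open>This settles uniqueness for the definite description. If u + T u = v + T' v with u and v
  fixed by Y, applying Y reverses the sign of T u and T' v, so sum and difference give u = v and T u
  = T' u. On ker(Y + 1) both matrices vanish.\<close>

lemma graph_coord_eq:
  fixes Y :: "real^'n^'n"
  assumes Y: "transpose Y = Y" "Y ** Y = mat 1"
    and T: "T \<in> graph_matrices {x. Y *v x = x}"
  shows "graph_coord {x. Y *v x = x} ((\<lambda>x. x + T *v x) ` {x. Y *v x = x}) = T"
proof -
  let ?P = "{x. Y *v x = x}"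
  have eqI: "T' = T" if T': "T' \<in> graph_matrices ?P" and
    eq: "(\<lambda>x. x + T *v x) ` ?P = (\<lambda>x. x + T' *v x) ` ?P" for T'
    unfolding matrix_eq
  proof
    fix x
    note neg = symmetric_involution_neg[OF Y]
    let ?u = "(1/2) *\<^sub>R (x + Y *v x)" and ?w = "(1/2) *\<^sub>R (x - Y *v x)"
    have u: "Y *v ?u = ?u" and w: "Y *v ?w = - ?w"
      by (rule involution_decomp[OF Y(2)])+
    have "?u + T *v ?u \<in> (\<lambda>x. x + T' *v x) ` ?P"
      unfolding eq[symmetric] using u by blast
    then obtain v where v: "Y *v v = v" "?u + T *v ?u = v + T' *v v"
      by blast
    have "Y *v (T *v ?u) = - (T *v ?u)" "Y *v (T' *v v) = - (T' *v v)"
      using T T' unfolding graph_matrices_def neg by auto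
    moreover have "Y *v (?u + T *v ?u) = Y *v (v + T' *v v)"
      by (simp only: v(2))
    ultimately have "?u - T *v ?u = v - T' *v v"
      by (simp only: matrix_vector_simps(2) u v(1) diff_conv_add_uminus)
    then have uv: "v = ?u"
      using sum_diff_eqD[OF v(2)] by (simp only:)
    then have "T' *v ?u = T *v ?u"
      using v(2) by (simp only: add_left_cancel)
    moreover have "T' *v ?w = 0" "T *v ?w = 0"
      using T T' w unfolding graph_matrices_def neg by blast+
    ultimately have "T' *v (?u + ?w) = T *v (?u + ?w)"
      by (simp only: matrix_vector_simps(2))
    then show "T' *v x = T *v x"
      by (simp only: half_sum_diff)
  qed
  show ?thesis
    unfolding graph_coord_def
  proof (rule the_equality)
    show "T' = T" if "(\<forall>x\<in>?P\<^sup>\<bottom>. T' *v x = 0) \<and> (\<forall>x. T' *v x \<in> ?P\<^sup>\<bottom>) \<and>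
        (\<lambda>x. x + T *v x) ` ?P = (\<lambda>x. x + T' *v x) ` ?P" for T'
      using that by (intro eqI) (auto simp: graph_matrices_def)
  qed (use T in \<open>auto simp: graph_matrices_def\<close>)
qed

text \<open>T is the lower left block, and subtracting the transpose completes it to a skew matrix
  with vanishing diagonal blocks. As T^T vanishes on ker(Y - 1), the maps 1 + A and 1 + T agree
  there.\<close>

lemma graph_matrices_skew:
  fixes Y :: "real^'n^'n"
  assumes Y: "transpose Y = Y" "Y ** Y = mat 1"
    and T: "T \<in> graph_matrices {x. Y *v x = x}"
  defines "A \<equiv> T - transpose T"
  shows "transpose A = - A" "Y ** A = - (A ** Y)"
    "(\<lambda>x. x + T *v x) ` {x. Y *v x = x} = (*v) (mat 1 + A) ` {x. Y *v x = x}"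
proof -
  have T': "T ** Y = T" "Y ** T = - T"
    using T graph_matrices_iff[OF Y] by auto
  have Tt: "Y ** transpose T = transpose T" "transpose T ** Y = - transpose T"
    using arg_cong[OF T'(1), of transpose] arg_cong[OF T'(2), of transpose] Y
    by (simp_all add: transpose_simps)
  show "transpose A = - A"
    by (simp add: A_def transpose_simps)
  show "Y ** A = - (A ** Y)"
    by (simp add: A_def matrix_mult_simps T' Tt)
  have "transpose T *v x = 0" if "Y *v x = x" for x
  proof -
    have "(transpose T ** Y) *v x = - (transpose T *v x)"
      by (simp only: Tt matrix_vector_simps)
    then have "transpose T *v x = - (transpose T *v x)"
      by (simp only: matrix_vector_mul_assoc[symmetric] that)
    then show ?thesis by (simp only: eq_minus_self_iff)
  qed
  then show "(\<lambda>x. x + T *v x) ` {x. Y *v x = x} = (*v) (mat 1 + A) ` {x. Y *v x = x}"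
    by (intro image_cong) (simp_all add: A_def matrix_vector_simps)
qed

text \<open>Provides the inverse of the graph chart. The factor 1 + A carries ker(Y - 1) onto ker(X
  - 1), and on ker(Y - 1) it is the graph map of T.\<close>

lemma graph_involution:
  fixes Y :: "real^'n^'n"
  assumes Y: "transpose Y = Y" "Y ** Y = mat 1"
    and T: "T \<in> graph_matrices {x. Y *v x = x}"
  defines "X \<equiv> Y ** cayley (T - transpose T)"
  shows "transpose X = X" "X ** X = mat 1" "dim {x. X *v x = x} = dim {x. Y *v x = x}"
    and "graph_coord {x. Y *v x = x} {x. X *v x = x} = T"
    and "det (mat 1 + Y ** X) \<noteq> 0"
proof -
  note A = graph_matrices_skew[OF Y T]
  have d: "det (mat 1 + (T - transpose T)) \<noteq> 0"
    by (rule det_one_plus_skew[OF A(1)])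
  note c = cayley_rel_cayley[OF d, THEN cayley_rel_sym]
  show "transpose X = X" "X ** X = mat 1" "dim {x. X *v x = x} = dim {x. Y *v x = x}"
    unfolding X_def using cayley_involution[OF Y c A(1,2)] by blast+
  have "{x. X *v x = x} = (*v) (mat 1 + (T - transpose T)) ` {x. Y *v x = x}"
    unfolding X_def by (rule fixed_intertwined[OF d cayley_involution_intertwined[OF c A(2)]])
  also have "\<dots> = (\<lambda>x. x + T *v x) ` {x. Y *v x = x}"
    using A(3) by simp
  finally show "graph_coord {x. Y *v x = x} {x. X *v x = x} = T"
    using graph_coord_eq[OF Y T] by simp
  have "Y ** X = cayley (T - transpose T)"
    by (simp only: X_def matrix_mul_assoc Y(2) matrix_mul_lid)
  then show "det (mat 1 + Y ** X) \<noteq> 0"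
    using det_cayley[OF d] by simp
qed

text \<open>A kernel vector x of 1 + Y X satisfies X x = -Y x, so its components lie in ker(X - 1)
  \<inter> ker(Y + 1) and ker(X + 1) \<inter> ker(Y - 1). Triviality of the first intersection and
  equality of dimensions make ker(X - 1) and ker(Y + 1) span everything, and a vector of the second
  intersection is orthogonal to both.\<close>

lemma transversal_iff_det:
  fixes X Y :: "real^'n^'n"
  assumes X: "transpose X = X" "X ** X = mat 1" and Y: "transpose Y = Y" "Y ** Y = mat 1"
    and dim: "dim {x. X *v x = x} = dim {x. Y *v x = x}"
  shows "{x. X *v x = x} \<inter> {x. Y *v x = x}\<^sup>\<bottom> = {0} \<longleftrightarrow> det (mat 1 + Y ** X) \<noteq> 0"
    (is "?V \<inter> _ = _ \<longleftrightarrow> _")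
proof
  note negY = symmetric_involution_neg[OF Y]
  assume det: "det (mat 1 + Y ** X) \<noteq> 0"
  show "?V \<inter> {x. Y *v x = x}\<^sup>\<bottom> = {0}"
  proof (intro antisym subsetI)
    fix x assume "x \<in> ?V \<inter> {x. Y *v x = x}\<^sup>\<bottom>"
    then have "(mat 1 + Y ** X) *v x = 0"
      unfolding negY by (simp add: matrix_vector_simps)
    then show "x \<in> {0}"
      using det unfolding det_nonzero_iff by blast
  qed (simp add: negY matrix_vector_simps)
next
  note negX = symmetric_involution_neg[OF X] and negY = symmetric_involution_neg[OF Y]
  assume triv: "?V \<inter> {x. Y *v x = x}\<^sup>\<bottom> = {0}"
  let ?W = "{x. Y *v x = x}\<^sup>\<bottom>"
  have sW: "subspace ?W"
    by (rule subspace_orthogonal_comp)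
  have "dim {x + y |x y. x \<in> ?V \<and> y \<in> ?W} = CARD('n)"
    using dim_sums_Int[OF subspace_fixed sW, of X] dim_orthogonal_comp[OF subspace_fixed, of Y] dim triv
    by simp
  then have "dim {x + y |x y. x \<in> ?V \<and> y \<in> ?W} = DIM(real^'n)"
    by simp
  then have sums: "{x + y |x y. x \<in> ?V \<and> y \<in> ?W} = UNIV"
    unfolding dim_eq_full using span_eq_iff[THEN iffD2, OF subspace_sums[OF subspace_fixed sW]] by metis
  show "det (mat 1 + Y ** X) \<noteq> 0"
    unfolding det_nonzero_iff
  proof (intro allI impI)
    fix x assume "(mat 1 + Y ** X) *v x = 0"
    then have "Y *v (x + Y *v (X *v x)) = 0"
      by (simp add: matrix_vector_simps)
    then have "Y *v x + X *v x = 0"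
      using Y(2) by (simp only: matrix_vector_simps(2) matrix_vector_mul_assoc matrix_mul_assoc matrix_mul_lid)
    then have XY: "X *v x = - (Y *v x)"
      by (metis add.commute eq_neg_iff_add_eq_0)
    have "(1/2) *\<^sub>R (x + X *v x) \<in> ?V"
      using involution_decomp(1)[OF X(2)] by blast
    then have "(1/2) *\<^sub>R (x - Y *v x) \<in> ?V"
      by (simp only: XY diff_conv_add_uminus)
    moreover have "(1/2) *\<^sub>R (x - Y *v x) \<in> ?W"
      unfolding negY using involution_decomp(2)[OF Y(2)] by blast
    ultimately have "(1/2) *\<^sub>R (x - Y *v x) = 0"
      using triv by blast
    then have "Y *v x = x" by simp
    moreover from this have "X *v x = - x" using XY by simp
    ultimately have x: "x \<in> ?V\<^sup>\<bottom>" "x \<in> {x. Y *v x = x}"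
      unfolding negX by simp_all
    have orthV: "v \<bullet> x = 0" if "v \<in> ?V" for v
      using that x(1) unfolding orthogonal_comp_iff by blast
    have "x \<bullet> v = 0" if "v \<in> ?W" for v
      using that x(2) unfolding orthogonal_comp_iff by blast
    then have orthW: "v \<bullet> x = 0" if "v \<in> ?W" for v
      using that by (simp only: inner_commute)
    obtain a b where "x = a + b" "a \<in> ?V" "b \<in> ?W"
      using sums by blast
    then have "x \<bullet> x = a \<bullet> x + b \<bullet> x"
      by (metis inner_add_left)
    then have "x \<bullet> x = 0"
      by (simp only: orthV[OF \<open>a \<in> ?V\<close>] orthW[OF \<open>b \<in> ?W\<close>] add_0)
    then show "x = 0" by simp
  qed
qed

text \<open>Since (1 + Y)/2 projects to ker(Y - 1), T is the coordinate A restricted to that space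
  and extended by zero. Anticommutation makes its values lie in ker(Y + 1), and skewness recovers A
  as T - T^T.\<close>

lemma graph_coord_involution:
  fixes X Y :: "real^'n^'n"
  assumes X: "transpose X = X" "X ** X = mat 1" and Y: "transpose Y = Y" "Y ** Y = mat 1"
    and det: "det (mat 1 + Y ** X) \<noteq> 0"
  defines "T \<equiv> (1/2) *\<^sub>R (cayley (Y ** X) + cayley (Y ** X) ** Y)"
  shows "graph_coord {x. Y *v x = x} {x. X *v x = x} = T"
    and "T \<in> graph_matrices {x. Y *v x = x}" and "X = Y ** cayley (T - transpose T)"
proof -
  define A where "A = cayley (Y ** X)"
  have A: "cayley_rel A (Y ** X)"
    unfolding A_def by (rule cayley_rel_cayley[OF det])
  note sk = cayley_of_involutions[OF Y X A]
  have AYY: "A ** Y ** Y = A"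
    by (simp only: matrix_mul_assoc[symmetric] Y(2) matrix_mul_rid)
  have "T ** Y = T"
    unfolding T_def A_def[symmetric] by (simp add: matrix_mult_simps AYY add.commute)
  moreover have "Y ** T = - T"
    unfolding T_def A_def[symmetric] by (simp add: matrix_mult_simps sk(2) AYY algebra_simps)
  ultimately show T: "T \<in> graph_matrices {x. Y *v x = x}"
    unfolding graph_matrices_iff[OF Y] by blast
  have "T - transpose T = A"
    unfolding T_def A_def[symmetric]
    by (simp add: transpose_simps sk Y(1) matrix_mult_simps flip: scaleR_diff_right)
  then have "cayley (T - transpose T) = Y ** X"
    using cayley_cayley[OF det] by (simp add: A_def)
  then show X': "X = Y ** cayley (T - transpose T)"
    by (simp only: matrix_mul_assoc Y(2) matrix_mul_lid)
  then show "graph_coord {x. Y *v x = x} {x. X *v x = x} = T"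
    using graph_involution(4)[OF Y T] by simp
qed

section \<open>Diffeomorphism with the Grassmannian\<close>

text \<open>Undoes both slicings: an arbitrary chart of \<open>S\<close> comes from a chart on an
  open set of matrices. Smoothness of the diffeomorphism is tested in these ambient
  coordinates.\<close>

lemma slice_atlas_orthogonal_groupE:
  assumes "(U, \<phi>) \<in> slice_atlas orthogonal_group_atlas S" "S \<subseteq> orthogonal_group"
  obtains U\<^sub>0 where "U = U\<^sub>0 \<inter> S" "open U\<^sub>0" "inj_on \<phi> U\<^sub>0" "open (\<phi> ` U\<^sub>0)"
    "smooth_on U\<^sub>0 \<phi>" "smooth_on (\<phi> ` U\<^sub>0) (inv_into U\<^sub>0 \<phi>)"
proof -
  obtain U1 where U1: "U = U1 \<inter> S" "(U1, \<phi>) \<in> orthogonal_group_atlas"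
    using assms(1) unfolding slice_atlas_def[of orthogonal_group_atlas] by blast
  then obtain U0 where "U1 = U0 \<inter> orthogonal_group" "(U0, \<phi>) \<in> euclidean_atlas"
    unfolding orthogonal_group_atlas_def slice_atlas_def by blast
  moreover from this U1 assms(2) have "U = U0 \<inter> S"
    by blast
  ultimately show ?thesis
    using that[of U0] by (simp add: euclidean_atlas_def)
qed

text \<open>Multiplying by \<open>transpose G\<close> undoes the translation, so G X is sent to the
  fixed space of X. Existence and uniqueness of the reflection in a given subspace yield
  bijectivity.\<close>

lemma bij_betw_eigenspace_grassmannian:
  fixes G :: "real^'n^'n"
  assumes G: "orthogonal_matrix G" and km: "k + m = CARD('n)"
  shows "bij_betw (\<lambda>H. {x. (transpose G ** H) *v x = x})
    (left_translation G ` sym_orthogonal k m) (grassmannian k)" (is "bij_betw ?F ?S _")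
proof -
  have GX: "transpose G ** (G ** X) = X" for X :: "real^'n^'n"
    using orthogonal_matrix_transpose_mult[OF G] by (simp add: matrix_mul_assoc)
  have F: "?F (left_translation G X) = {x. X *v x = x}" for X
    by (simp only: left_translation_def GX)
  show ?thesis
    unfolding bij_betw_def
  proof
    show "inj_on ?F ?S"
    proof (rule inj_onI)
      fix H H' assume "H \<in> ?S" "H' \<in> ?S" "?F H = ?F H'"
      then obtain X X' where *: "H = left_translation G X" "H' = left_translation G X'"
        "X \<in> sym_orthogonal k m" "X' \<in> sym_orthogonal k m" by blast
      then have X: "transpose X = X" "X ** X = mat 1" "transpose X' = X'" "X' ** X' = mat 1"
        by (simp_all add: sym_orthogonal_iff)
      have "X = X'"
        by (rule symmetric_involution_unique[OF X]) (use \<open>?F H = ?F H'\<close> in \<open>simp only: * F\<close>)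
      then show "H = H'" using * by simp
    qed
    show "?F ` ?S = grassmannian k"
      unfolding image_image F
    proof (intro set_eqI iffI)
      fix V assume "V \<in> (\<lambda>X. {x. X *v x = x}) ` sym_orthogonal k m"
      then show "V \<in> grassmannian k"
        using subspace_fixed by (auto simp: grassmannian_def sym_orthogonal_iff)
    next
      fix V :: "(real^'n) set" assume "V \<in> grassmannian k"
      then have V: "subspace V" "dim V = k" by (auto simp: grassmannian_def)
      obtain X where "transpose X = X" "X ** X = mat 1" "{x. X *v x = x} = V"
        by (rule symmetric_involution_exists[OF V(1)])
      then show "V \<in> (\<lambda>X. {x. X *v x = x}) ` sym_orthogonal k m"
        using V(2) sym_orthogonal_iff_dim[OF km, of X] by (intro image_eqI[of _ _ X]) auto
    qed
  qed
qed

text \<open>With A the Cayley transform of Y G^T H, the graph coordinate of the image of H is (A + A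
  Y)/2, which is smooth in H on an open set of matrices.\<close>

lemma smooth_map_eigenspace:
  fixes G :: "real^'n^'n"
  assumes G: "orthogonal_matrix G" and km: "k + m = CARD('n)"
  defines "S \<equiv> left_translation G ` sym_orthogonal k m"
    and "F \<equiv> \<lambda>H. {x. (transpose G ** H) *v x = x}"
  shows "smooth_map S (slice_atlas orthogonal_group_atlas S) (grassmannian k) (grassmannian_atlas k) F"
proof -
  have FS: "F ` S = grassmannian k"
    using bij_betw_eigenspace_grassmannian[OF G km] by (simp add: bij_betw_def S_def F_def)
  have SO: "S \<subseteq> orthogonal_group"
    unfolding S_def by (rule left_translation_sym_orthogonal_subset[OF G])
  have GS: "transpose G ** H \<in> sym_orthogonal k m" if "H \<in> S" for H
    using that orthogonal_matrix_transpose_mult[OF G]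
    by (auto simp: S_def left_translation_def matrix_mul_assoc)
  have main: "openin (top_of_set (\<phi> ` U)) (\<phi> ` (U \<inter> F -` V)) \<and>
      smooth_on (\<phi> ` (U \<inter> F -` V)) (\<psi> \<circ> F \<circ> inv_into U \<phi>)"
    if chart: "(U, \<phi>) \<in> slice_atlas orthogonal_group_atlas S" and "(V, \<psi>) \<in> grassmannian_atlas k"
    for U \<phi> V \<psi>
  proof -
    obtain P where P: "P \<in> grassmannian k" and V: "V = {V \<in> grassmannian k. V \<inter> P\<^sup>\<bottom> = {0}}"
      and \<psi>: "\<psi> = graph_coord P"
      using \<open>(V, \<psi>) \<in> _\<close> by (auto simp: grassmannian_atlas_def)
    have sP: "subspace P" and dP: "dim P = k"
      using P by (auto simp: grassmannian_def)
    obtain Y where Y: "transpose Y = Y" "Y ** Y = mat 1" and PY: "{x. Y *v x = x} = P"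
      by (rule symmetric_involution_exists[OF sP])
    obtain U\<^sub>0 where U: "U = U\<^sub>0 \<inter> S" and U0: "open U\<^sub>0" "inj_on \<phi> U\<^sub>0" "open (\<phi> ` U\<^sub>0)"
      "smooth_on U\<^sub>0 \<phi>" "smooth_on (\<phi> ` U\<^sub>0) (inv_into U\<^sub>0 \<phi>)"
      by (rule slice_atlas_orthogonal_groupE[OF chart SO])
    let ?h = "\<lambda>H. Y ** (transpose G ** H)"
    have FV: "F H \<in> V \<longleftrightarrow> det (mat 1 + ?h H) \<noteq> 0" if "H \<in> S" for H
    proof -
      have "F H \<in> grassmannian k" using FS that by blast
      moreover have "{x. (transpose G ** H) *v x = x} \<inter> {x. Y *v x = x}\<^sup>\<bottom> = {0} \<longleftrightarrow> det (mat 1 + ?h H) \<noteq> 0"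
        using GS[OF that] dP unfolding sym_orthogonal_iff
        by (intro transversal_iff_det[OF _ _ Y]) (simp_all add: PY)
      ultimately show ?thesis
        unfolding V F_def PY by simp
    qed
    have inv: "inv_into U\<^sub>0 \<phi> (\<phi> H) = H" "inv_into U \<phi> (\<phi> H) = H" if "H \<in> U" for H
      using that U0(2) inj_on_subset[OF U0(2), of U] U by (auto simp: inv_into_f_f)
    \<comment> \<open>Formed with the inverse of the ambient chart, which is smooth on an open set.
      The relative openness in \<open>smooth_map\<close> follows because the image in question is
      the trace of this open set on the image of \<open>U\<close>.\<close>
    let ?D = "{y \<in> \<phi> ` U\<^sub>0. det (mat 1 + ?h (inv_into U\<^sub>0 \<phi> y)) \<noteq> 0}"
    have sm: "smooth_on (\<phi> ` U\<^sub>0) (\<lambda>y. ?h (inv_into U\<^sub>0 \<phi> y))"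
      by (rule smooth_on_matrix_mult_const(1)[OF smooth_on_matrix_mult_const(1)[OF U0(5)]])
    have "open ?D"
      by (rule open_det_nonzero[OF smooth_on_add[OF smooth_on_const sm] U0(3)])
    have im: "\<phi> ` (U \<inter> F -` V) = \<phi> ` U \<inter> ?D"
    proof (intro set_eqI iffI)
      fix y assume "y \<in> \<phi> ` (U \<inter> F -` V)"
      then obtain H where "y = \<phi> H" "H \<in> U" "F H \<in> V" by blast
      then show "y \<in> \<phi> ` U \<inter> ?D"
        using FV[of H] inv(1)[of H] U by auto
    next
      fix y assume "y \<in> \<phi> ` U \<inter> ?D"
      then obtain H where "y = \<phi> H" "H \<in> U" "det (mat 1 + ?h (inv_into U\<^sub>0 \<phi> y)) \<noteq> 0" by blast
      then show "y \<in> \<phi> ` (U \<inter> F -` V)"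
        using FV[of H] inv(1)[of H] U by auto
    qed
    show ?thesis
    proof
      show "openin (top_of_set (\<phi> ` U)) (\<phi> ` (U \<inter> F -` V))"
        unfolding im by (rule openin_open_Int[OF \<open>open ?D\<close>])
      let ?A = "\<lambda>y. cayley (?h (inv_into U\<^sub>0 \<phi> y))"
      have smA: "smooth_on ?D ?A"
        by (rule smooth_on_cayley[OF smooth_on_subset[OF sm]]) auto
      have "smooth_on ?D (\<lambda>y. (1/2) *\<^sub>R (?A y + ?A y ** Y))"
        by (rule smooth_on_scaleR_left[OF smooth_on_add[OF smA smooth_on_matrix_mult_const(2)[OF smA]]])
      then have "smooth_on (\<phi> ` (U \<inter> F -` V)) (\<lambda>y. (1/2) *\<^sub>R (?A y + ?A y ** Y))"
        by (rule smooth_on_subset) (simp add: im)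
      then show "smooth_on (\<phi> ` (U \<inter> F -` V)) (\<psi> \<circ> F \<circ> inv_into U \<phi>)"
      proof (rule smooth_on_cong)
        fix y assume "y \<in> \<phi> ` (U \<inter> F -` V)"
        then obtain H where H: "y = \<phi> H" "H \<in> U" "F H \<in> V" by blast
        have HS: "H \<in> S" using H U by blast
        have d: "det (mat 1 + ?h H) \<noteq> 0"
          using FV[OF HS] H(3) by blast
        have "graph_coord {x. Y *v x = x} (F H)
            = (1/2) *\<^sub>R (cayley (?h H) + cayley (?h H) ** Y)"
          unfolding F_def
          by (rule graph_coord_involution(1)[OF _ _ Y d]) (use GS[OF HS] in \<open>auto simp: sym_orthogonal_iff\<close>)
        then show "(1/2) *\<^sub>R (?A y + ?A y ** Y) = (\<psi> \<circ> F \<circ> inv_into U \<phi>) y"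
          by (simp add: H(1) inv[OF H(2)] \<psi> PY)
      qed
    qed
  qed
  then show ?thesis
    unfolding smooth_map_def using FS by (intro conjI) auto
qed

lemma smooth_map_inv_eigenspace:
  fixes G :: "real^'n^'n"
  assumes G: "orthogonal_matrix G" and km: "k + m = CARD('n)"
  defines "S \<equiv> left_translation G ` sym_orthogonal k m"
    and "F \<equiv> \<lambda>H. {x. (transpose G ** H) *v x = x}"
  shows "smooth_map (grassmannian k) (grassmannian_atlas k) S (slice_atlas orthogonal_group_atlas S)
    (inv_into S F)"
proof -
  have bij: "bij_betw F S (grassmannian k)"
    using bij_betw_eigenspace_grassmannian[OF G km] by (simp add: S_def F_def)
  have SO: "S \<subseteq> orthogonal_group"
    unfolding S_def by (rule left_translation_sym_orthogonal_subset[OF G])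
  have GX: "transpose G ** (G ** X) = X" for X :: "real^'n^'n"
    using orthogonal_matrix_transpose_mult[OF G] by (simp add: matrix_mul_assoc)
  have F: "F (G ** X) = {x. X *v x = x}" for X
    by (simp only: F_def GX)
  have invF: "inv_into S F {x. X *v x = x} = G ** X" "G ** X \<in> S" "{x. X *v x = x} \<in> grassmannian k"
    if "X \<in> sym_orthogonal k m" for X
  proof -
    show GS: "G ** X \<in> S"
      using that by (auto simp: S_def left_translation_def)
    then have "inv_into S F (F (G ** X)) = G ** X"
      using bij by (intro inv_into_f_f) (auto simp: bij_betw_def)
    then show "inv_into S F {x. X *v x = x} = G ** X"
      unfolding F .
    show "{x. X *v x = x} \<in> grassmannian k"
      using GS bij F unfolding bij_betw_def by blast
  qed
  have main: "openin (top_of_set (\<psi> ` V)) (\<psi> ` (V \<inter> inv_into S F -` U)) \<and>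
      smooth_on (\<psi> ` (V \<inter> inv_into S F -` U)) (\<phi> \<circ> inv_into S F \<circ> inv_into V \<psi>)"
    if chart: "(U, \<phi>) \<in> slice_atlas orthogonal_group_atlas S" and "(V, \<psi>) \<in> grassmannian_atlas k"
    for U \<phi> V \<psi>
  proof -
    obtain P where P: "P \<in> grassmannian k" and V: "V = {V \<in> grassmannian k. V \<inter> P\<^sup>\<bottom> = {0}}"
      and \<psi>: "\<psi> = graph_coord P"
      using \<open>(V, \<psi>) \<in> _\<close> by (auto simp: grassmannian_atlas_def)
    have sP: "subspace P" and dP: "dim P = k"
      using P by (auto simp: grassmannian_def)
    obtain Y where Y: "transpose Y = Y" "Y ** Y = mat 1" and PY: "{x. Y *v x = x} = P"
      by (rule symmetric_involution_exists[OF sP])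
    obtain U\<^sub>0 where U: "U = U\<^sub>0 \<inter> S" and U0: "open U\<^sub>0" "smooth_on U\<^sub>0 \<phi>"
      by (rule slice_atlas_orthogonal_groupE[OF chart SO])
    \<comment> \<open>\<open>J T\<close> is the involution whose fixed space is the graph of
      \<open>T\<close>. The facts \<open>J\<close> and \<open>VJ\<close> below say that sending
      \<open>T\<close> to this fixed space inverts the graph chart on
      \<open>graph_matrices P\<close>.\<close>
    define J where "J T = Y ** cayley (T - transpose T)" for T
    let ?fix = "\<lambda>X :: real^'n^'n. {x. X *v x = x}"
    have J: "J T \<in> sym_orthogonal k m" "?fix (J T) \<in> V" "\<psi> (?fix (J T)) = T"
      if "T \<in> graph_matrices P" for T
    proof -
      note T = graph_involution[OF Y that[folded PY], folded J_def, unfolded PY dP]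
      show JT: "J T \<in> sym_orthogonal k m"
        using T unfolding sym_orthogonal_iff_dim[OF km] by blast
      show "\<psi> (?fix (J T)) = T"
        using T(4) \<psi> by simp
      have "?fix (J T) \<inter> ?fix Y\<^sup>\<bottom> = {0}"
        using transversal_iff_det[OF T(1,2) Y] T(3,5) PY dP by simp
      then show "?fix (J T) \<in> V"
        unfolding V using invF(3)[OF JT] PY by simp
    qed
    have VJ: "\<psi> W \<in> graph_matrices P" "W = ?fix (J (\<psi> W))" if "W \<in> V" for W
    proof -
      have "W \<in> grassmannian k" using that V by blast
      then have "W \<in> F ` S"
        by (simp only: bij_betw_imp_surj_on[OF bij])
      then obtain H where "H \<in> S" "W = F H" by (rule imageE)
      moreover from this obtain X where X: "X \<in> sym_orthogonal k m" and "H = G ** X"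
        unfolding S_def left_translation_def by (elim imageE)
      ultimately have W: "W = ?fix X"
        by (simp only: F)
      have Xs: "transpose X = X" "X ** X = mat 1" "dim (?fix X) = k"
        using X by (auto simp: sym_orthogonal_iff)
      have "?fix X \<inter> ?fix Y\<^sup>\<bottom> = {0}"
        using that unfolding V W PY by blast
      then have d: "det (mat 1 + Y ** X) \<noteq> 0"
        using transversal_iff_det[OF Xs(1,2) Y] Xs(3) PY dP by simp
      note gc = graph_coord_involution[OF Xs(1,2) Y d, unfolded PY, folded W \<psi>]
      show "\<psi> W \<in> graph_matrices P"
        using gc(1,2) by simp
      have "X = J (\<psi> W)"
        unfolding J_def gc(1) by (rule gc(3))
      then show "W = ?fix (J (\<psi> W))"
        unfolding W by simp
    qed
    have im: "\<psi> ` (V \<inter> inv_into S F -` U) = \<psi> ` V \<inter> {T. G ** J T \<in> U\<^sub>0}"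
    proof (intro set_eqI iffI)
      fix T assume "T \<in> \<psi> ` (V \<inter> inv_into S F -` U)"
      then obtain W where W: "T = \<psi> W" "W \<in> V" "inv_into S F W \<in> U" by blast
      have g: "T \<in> graph_matrices P"
        unfolding W(1) by (rule VJ(1)[OF W(2)])
      have "W = ?fix (J T)"
        unfolding W(1) by (rule VJ(2)[OF W(2)])
      then have "inv_into S F W = G ** J T"
        using invF(1)[OF J(1)[OF g]] by (simp only:)
      then show "T \<in> \<psi> ` V \<inter> {T. G ** J T \<in> U\<^sub>0}"
        using W U by auto
    next
      fix T assume T: "T \<in> \<psi> ` V \<inter> {T. G ** J T \<in> U\<^sub>0}"
      then have g: "T \<in> graph_matrices P" using VJ(1) by blast
      have "G ** J T \<in> U"
        unfolding U using T invF(2)[OF J(1)[OF g]] by blast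
      then have "?fix (J T) \<in> V \<inter> inv_into S F -` U"
        using J(2)[OF g] invF(1)[OF J(1)[OF g]] by simp
      then show "T \<in> \<psi> ` (V \<inter> inv_into S F -` U)"
        by (rule image_eqI[of _ \<psi> "?fix (J T)", OF J(3)[OF g, symmetric]])
    qed
    \<comment> \<open>T - T^T is skew for every matrix T, so the formula for \<open>J\<close> is
      smooth on the whole matrix space and serves as the extension required by
      \<open>smooth_on\<close>.\<close>
    have smA: "smooth_on UNIV (\<lambda>T :: real^'n^'n. T - transpose T)"
      by (rule smooth_on_diff[OF smooth_on_id smooth_on_transpose[OF smooth_on_id]])
    have "smooth_on UNIV (\<lambda>T :: real^'n^'n. cayley (T - transpose T))"
      by (rule smooth_on_cayley[OF smA det_one_plus_skew]) (simp add: transpose_simps)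
    then have smJ: "smooth_on UNIV (\<lambda>T. G ** J T)"
      unfolding J_def by (intro smooth_on_matrix_mult_const(1))
    show ?thesis
    proof
      have "open {T. G ** J T \<in> U\<^sub>0}"
        using open_vimage[OF U0(1) smooth_on_continuous_on[OF smJ]] by (simp only: vimage_def)
      then show "openin (top_of_set (\<psi> ` V)) (\<psi> ` (V \<inter> inv_into S F -` U))"
        unfolding im by (rule openin_open_Int)
      have "smooth_on (\<psi> ` (V \<inter> inv_into S F -` U)) (\<lambda>T. \<phi> (G ** J T))"
        by (rule smooth_on_compose[OF smooth_on_subset[OF smJ] U0(2)]) (auto simp: im)
      then show "smooth_on (\<psi> ` (V \<inter> inv_into S F -` U)) (\<phi> \<circ> inv_into S F \<circ> inv_into V \<psi>)"
      proof (rule smooth_on_cong)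
        fix T assume "T \<in> \<psi> ` (V \<inter> inv_into S F -` U)"
        then have T: "T \<in> \<psi> ` V" by blast
        then have W: "inv_into V \<psi> T \<in> V" "\<psi> (inv_into V \<psi> T) = T"
          by (auto intro: inv_into_into f_inv_into_f)
        have g: "T \<in> graph_matrices P"
          using VJ(1) T by blast
        have "inv_into V \<psi> T = ?fix (J T)"
          using VJ(2)[OF W(1)] unfolding W(2) .
        then show "\<phi> (G ** J T) = (\<phi> \<circ> inv_into S F \<circ> inv_into V \<psi>) T"
          using invF(1)[OF J(1)[OF g]] by simp
      qed
    qed
  qed
  have "inv_into S F ` grassmannian k \<subseteq> S"
    using bij_betw_inv_into[OF bij] by (simp add: bij_betw_def)
  then show ?thesis
    unfolding smooth_map_def using main by (intro conjI) auto
qed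

lemma diffeomorphic_left_translation_sym_orthogonal:
  fixes G :: "real^'n^'n"
  assumes G: "orthogonal_matrix G" and km: "k + m = CARD('n)"
  shows "diffeomorphic (left_translation G ` sym_orthogonal k m)
    (slice_atlas orthogonal_group_atlas (left_translation G ` sym_orthogonal k m))
    (grassmannian k :: (real^'n) set set) (grassmannian_atlas k)"
  unfolding diffeomorphic_def
  using bij_betw_eigenspace_grassmannian[OF G km] smooth_map_eigenspace[OF G km]
    smooth_map_inv_eigenspace[OF G km]
  by (intro exI[of _ "\<lambda>H. {x. (transpose G ** H) *v x = x}"] conjI)

section \<open>Geodesics of the orthogonal group\<close>

lemma smooth_on_has_vector_derivative:
  fixes c :: "real \<Rightarrow> 'a::euclidean_space"
  assumes "smooth_on S c" "open S" "t \<in> S"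
  shows "(c has_vector_derivative vector_derivative c (at t)) (at t)"
proof -
  have "Ck_on (Suc 0) S c"
    using assms(1) smooth_on_open_iff[OF assms(2)] by blast
  then have "c differentiable (at t)"
    using assms(3) by (simp add: Ck_on.simps(2))
  then show ?thesis
    by (simp add: vector_derivative_works)
qed

lemma smooth_on_vector_derivative:
  fixes c :: "real \<Rightarrow> 'a::euclidean_space"
  assumes "smooth_on S c" "open S"
  shows "smooth_on S (\<lambda>t. vector_derivative c (at t))"
  unfolding smooth_on_open_iff[OF assms(2)]
proof
  fix k
  have c: "Ck_on (Suc k) S c"
    using assms(1) smooth_on_open_iff[OF assms(2)] by blast
  then have "frechet_derivative c (at t) 1 = vector_derivative c (at t)" if "t \<in> S" for t
    using that by (simp add: Ck_on.simps(2) frechet_derivative_eq_vector_derivative)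
  then show "Ck_on k S (\<lambda>t. vector_derivative c (at t))"
    by (rule Ck_on_cong[OF assms(2) _ Ck_on_Suc_deriv[OF c]])
qed

lemmas has_vector_derivative_matrix_mult =
  bounded_bilinear.has_vector_derivative[OF bounded_bilinear_matrix_mult]

lemma bounded_linear_transpose: "bounded_linear (transpose :: real^'n^'n \<Rightarrow> real^'n^'n)"
  unfolding linear_conv_bounded_linear[symmetric] linear_iff
  by (simp add: transpose_add transpose_scalar)

lemmas has_vector_derivative_transpose =
  bounded_linear.has_vector_derivative[OF bounded_linear_transpose]

lemma has_vector_derivative_matrix_mult_const:
  fixes c :: "real \<Rightarrow> real^'n^'n"
  assumes "(c has_vector_derivative v) (at t)"
  shows "((\<lambda>s. A ** c s) has_vector_derivative A ** v) (at t)"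
    "((\<lambda>s. c s ** A) has_vector_derivative v ** A) (at t)"
  using has_vector_derivative_matrix_mult[OF has_vector_derivative_const assms, of A]
    has_vector_derivative_matrix_mult[OF assms has_vector_derivative_const, of A]
  by (simp_all add: matrix_mult_simps)

text \<open>Obtained by differentiating c^T c = 1. It bounds the tangent spaces from above and makes
  the body velocity of a geodesic skew.\<close>

lemma orthogonal_curve_derivative:
  fixes c :: "real \<Rightarrow> real^'n^'n"
  assumes "open T" "t \<in> T" "\<And>s. s \<in> T \<Longrightarrow> orthogonal_matrix (c s)"
    and c: "(c has_vector_derivative v) (at t)"
  shows "transpose (transpose (c t) ** v) = - (transpose (c t) ** v)"
proof -
  have "((\<lambda>s. transpose (c s) ** c s) has_vector_derivative
      transpose (c t) ** v + transpose v ** c t) (at t)"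
    by (rule has_vector_derivative_matrix_mult[OF has_vector_derivative_transpose[OF c] c])
  moreover have "((\<lambda>s. transpose (c s) ** c s) has_vector_derivative 0) (at t)"
    by (rule has_vector_derivative_transform_within_open[OF has_vector_derivative_const assms(1,2)])
      (use assms(3) orthogonal_matrix_transpose_mult in \<open>simp add: orthogonal_matrix_transpose_mult\<close>)
  ultimately have "transpose (c t) ** v + transpose v ** c t = 0"
    by (rule vector_derivative_unique_at)
  then show ?thesis
    by (simp add: transpose_simps eq_neg_iff_add_eq_0 add.commute)
qed

lemma tangent_space_orthogonal_groupD:
  fixes g v :: "real^'n^'n"
  assumes "v \<in> tangent_space orthogonal_group g"
  shows "transpose (transpose g ** v) = - (transpose g ** v)"
proof -
  obtain c \<epsilon> where c: "\<epsilon> > (0::real)" "c ` {-\<epsilon><..<\<epsilon>} \<subseteq> orthogonal_group" "c 0 = g"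
    "(c has_vector_derivative v) (at 0)"
    using assms by (auto simp: tangent_space_def)
  have "orthogonal_matrix (c s)" if "s \<in> {-\<epsilon><..<\<epsilon>}" for s
    using c(2) that unfolding orthogonal_group_def by blast
  then have "transpose (transpose (c 0) ** v) = - (transpose (c 0) ** v)"
    by (intro orthogonal_curve_derivative[of "{-\<epsilon><..<\<epsilon>}", OF _ _ _ c(4)]) (use c(1) in auto)
  then show ?thesis by (simp add: c(3))
qed

text \<open>The Cayley transform replaces the exponential map in producing curves with a prescribed velocity.\<close>

lemma tangent_space_orthogonal_groupI:
  fixes g B :: "real^'n^'n"
  assumes g: "orthogonal_matrix g" and B: "transpose B = - B"
  shows "g ** B \<in> tangent_space orthogonal_group g"
proof -
  \<comment> \<open>To first order at 0 the Cayley transform of A is 1 - 2 A, so the factor -s/2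
    gives the curve the velocity B at s = 0.\<close>
  let ?A = "\<lambda>s. (- s / 2) *\<^sub>R B"
  define c where "c s = cayley (?A s)" for s
  have sk: "transpose (?A s) = - ?A s" for s
    using B by (simp only: transpose_scalar scaleR_minus_right)
  note d = det_one_plus_skew[OF sk]
  have rel: "cayley_rel (?A s) (c s)" for s
    unfolding c_def by (rule cayley_rel_sym[OF cayley_rel_cayley[OF d]])
  have c0: "c 0 = mat 1"
    using cayley_rel_mult[OF rel, of 0] by (simp add: matrix_mult_simps)
  have orth: "orthogonal_matrix (c s)" for s
    unfolding orthogonal_matrix using cayley_rel_skew_iff[OF rel] sk by blast
  have lin: "linear (\<lambda>s. (- s / 2) *\<^sub>R B)"
    by (auto simp: linear_iff algebra_simps add_divide_distrib diff_divide_distrib)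
  have smA: "smooth_on UNIV ?A"
    by (rule smooth_on_linear_compose[OF lin smooth_on_id])
  have sm: "smooth_on UNIV c"
    unfolding c_def by (rule smooth_on_cayley[OF smA d])
  define w where "w = vector_derivative c (at 0)"
  have cw: "(c has_vector_derivative w) (at 0)"
    unfolding w_def by (rule smooth_on_has_vector_derivative[OF sm]) auto
  have dA: "(?A has_vector_derivative (- 1 / 2) *\<^sub>R B) (at 0)"
    using bounded_linear_imp_has_derivative[OF lin[unfolded linear_conv_bounded_linear], of "at 0"]
    by (simp add: has_vector_derivative_def)
  \<comment> \<open>Instead of the inverse in \<open>cayley\<close>, the identity c (1 + A) = 1 - A
    is differentiated; as c(0) = 1, it yields w - B/2 = B/2.\<close>
  have "((\<lambda>s. c s ** (mat 1 + ?A s)) has_vector_derivative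
      c 0 ** (0 + (- 1 / 2) *\<^sub>R B) + w ** (mat 1 + ?A 0)) (at 0)"
    by (rule has_vector_derivative_matrix_mult[OF cw has_vector_derivative_add[OF has_vector_derivative_const dA]])
  moreover have "((\<lambda>s. c s ** (mat 1 + ?A s)) has_vector_derivative 0 - (- 1 / 2) *\<^sub>R B) (at 0)"
    unfolding cayley_rel_mult[OF rel]
    by (rule has_vector_derivative_diff[OF has_vector_derivative_const dA])
  ultimately have "c 0 ** (0 + (- 1 / 2) *\<^sub>R B) + w ** (mat 1 + ?A 0) = 0 - (- 1 / 2) *\<^sub>R B"
    by (rule vector_derivative_unique_at)
  then have "w - (1/2) *\<^sub>R B = (1/2) *\<^sub>R B"
    by (simp add: c0 matrix_mult_simps)
  then have "w = (1/2) *\<^sub>R B + (1/2) *\<^sub>R B"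
    by (simp only: diff_eq_eq)
  then have w: "w = B"
    by (simp flip: scaleR_add_left)
  have "((\<lambda>s. g ** c s) has_vector_derivative g ** B) (at 0)"
    using has_vector_derivative_matrix_mult_const(1)[OF cw] by (simp only: w)
  moreover have "smooth_on {-1<..<1} (\<lambda>s. g ** c s)"
    by (rule smooth_on_subset[OF smooth_on_matrix_mult_const(1)[OF sm]]) simp
  ultimately show ?thesis
    unfolding tangent_space_def mem_Collect_eq
    using orthogonal_matrix_mul[OF g orth]
    by (intro exI[of _ "\<lambda>s. g ** c s"] exI[of _ 1]) (auto simp: orthogonal_group_def c0)
qed

section \<open>The Frobenius inner product, symmetric and skew matrices\<close>

lemma frobenius_eq_inner: "frobenius V W = V \<bullet> W"
proof -
  have "frobenius V W = (\<Sum>j\<in>UNIV. \<Sum>i\<in>UNIV. V $ i $ j * W $ i $ j)"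
    by (simp add: frobenius_def trace_def matrix_matrix_mult_def transpose_def)
  also have "\<dots> = V \<bullet> W"
    by (subst sum.swap) (simp add: inner_vec_def)
  finally show ?thesis .
qed

lemma inner_transpose: "transpose V \<bullet> transpose W = V \<bullet> (W :: real^'n^'n)"
  unfolding inner_vec_def transpose_def by (simp only: vec_lambda_beta) (rule sum.swap)

lemma inner_matrix_mult:
  fixes M N P :: "real^'n^'n"
  shows "(transpose P ** M) \<bullet> N = M \<bullet> (P ** N)"
  by (simp only: frobenius_eq_inner[symmetric] frobenius_def transpose_simps matrix_mul_assoc)

lemma inner_symmetric_skew:
  fixes M N :: "real^'n^'n"
  assumes "transpose M = M" "transpose N = - N"
  shows "M \<bullet> N = 0"
  using inner_transpose[of M N] assms by simp

text \<open>The test matrix is B = M - M^T. Transposition gives M^T.B = -M.B, and M.B = 0 by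
  hypothesis, so B.B = 0.\<close>

lemma symmetric_if_orthogonal_to_skew:
  fixes M :: "real^'n^'n"
  assumes "\<And>B. transpose B = - B \<Longrightarrow> M \<bullet> B = 0"
  shows "transpose M = M"
proof -
  let ?B = "M - transpose M"
  have "M \<bullet> ?B = 0"
    by (rule assms) (simp add: transpose_simps)
  moreover have "transpose M \<bullet> ?B = M \<bullet> (transpose M - M)"
    using inner_transpose[of M "transpose M - M"] by (simp only: transpose_diff transpose_transpose)
  then have "transpose M \<bullet> ?B = - (M \<bullet> ?B)"
    by (simp only: inner_minus_right[symmetric] minus_diff_eq)
  ultimately have "M \<bullet> ?B - transpose M \<bullet> ?B = 0"
    by (simp only: minus_zero diff_self)
  then have "?B \<bullet> ?B = 0"
    by (simp only: inner_diff_left)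
  then have "?B = 0"
    by (simp only: inner_eq_zero_iff)
  then show ?thesis
    by (simp only: right_minus_eq)
qed

text \<open>The body velocity \<open>\<gamma>\<^sup>T \<gamma>'\<close> is skew, and the geodesic equation makes its derivative symmetric.\<close>

lemma geodesic_orthogonal_group_derivative:
  fixes \<gamma> :: "real \<Rightarrow> real^'n^'n"
  assumes "geodesic orthogonal_group frobenius \<gamma>"
  obtains A where "transpose A = - A" "\<And>t. (\<gamma> has_vector_derivative \<gamma> t ** A) (at t)"
proof -
  have sm: "smooth_on UNIV \<gamma>" and orth: "\<And>t. orthogonal_matrix (\<gamma> t)"
    and acc: "\<And>t v. v \<in> tangent_space orthogonal_group (\<gamma> t) \<Longrightarrow>
      frobenius (vector_derivative (\<lambda>s. vector_derivative \<gamma> (at s)) (at t)) v = 0"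
    using assms unfolding geodesic_def orthogonal_group_def by auto
  define \<gamma>' where "\<gamma>' t = vector_derivative \<gamma> (at t)" for t
  define \<gamma>'' where "\<gamma>'' t = vector_derivative \<gamma>' (at t)" for t
  have d1: "(\<gamma> has_vector_derivative \<gamma>' t) (at t)" for t
    unfolding \<gamma>'_def by (rule smooth_on_has_vector_derivative[OF sm]) auto
  have "smooth_on UNIV \<gamma>'"
    unfolding \<gamma>'_def by (rule smooth_on_vector_derivative[OF sm open_UNIV])
  then have d2: "(\<gamma>' has_vector_derivative \<gamma>'' t) (at t)" for t
    unfolding \<gamma>''_def by (rule smooth_on_has_vector_derivative) auto
  define A where "A t = transpose (\<gamma> t) ** \<gamma>' t" for t
  have skew: "transpose (A t) = - A t" for t
    unfolding A_def by (rule orthogonal_curve_derivative[OF open_UNIV _ _ d1]) (auto simp: orth)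
  have dA: "(A has_vector_derivative transpose (\<gamma> t) ** \<gamma>'' t + transpose (\<gamma>' t) ** \<gamma>' t) (at t)" for t
    unfolding A_def
    by (rule has_vector_derivative_matrix_mult[OF has_vector_derivative_transpose[OF d1] d2])
  have "transpose (transpose (\<gamma> t) ** \<gamma>'' t) = transpose (\<gamma> t) ** \<gamma>'' t" for t
  proof (rule symmetric_if_orthogonal_to_skew)
    fix B :: "real^'n^'n" assume "transpose B = - B"
    then have "frobenius (\<gamma>'' t) (\<gamma> t ** B) = 0"
      using acc[OF tangent_space_orthogonal_groupI[OF orth]] by (simp add: \<gamma>''_def \<gamma>'_def[abs_def])
    then show "(transpose (\<gamma> t) ** \<gamma>'' t) \<bullet> B = 0"
      by (simp only: inner_matrix_mult frobenius_eq_inner)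
  qed
  \<comment> \<open>The second summand of the derivative of \<open>A\<close> is symmetric by its
    form; the geodesic equation enters through the first.\<close>
  then have sym: "transpose (transpose (\<gamma> t) ** \<gamma>'' t + transpose (\<gamma>' t) ** \<gamma>' t)
      = transpose (\<gamma> t) ** \<gamma>'' t + transpose (\<gamma>' t) ** \<gamma>' t" for t
    by (simp only: transpose_add) (simp add: matrix_transpose_mul)
  have "(A has_vector_derivative 0) (at t)" for t
  proof -
    let ?D = "transpose (\<gamma> t) ** \<gamma>'' t + transpose (\<gamma>' t) ** \<gamma>' t"
    have "((\<lambda>t. transpose (A t)) has_vector_derivative transpose ?D) (at t)"
      by (rule has_vector_derivative_transpose[OF dA])
    moreover have "((\<lambda>t. transpose (A t)) has_vector_derivative - ?D) (at t)"
      unfolding skew by (rule has_vector_derivative_minus[OF dA])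
    ultimately have "transpose ?D = - ?D"
      by (rule vector_derivative_unique_at)
    then have "?D = 0"
      unfolding sym eq_minus_self_iff .
    then show ?thesis using dA[of t] by (simp only:)
  qed
  then obtain A0 where A0: "\<And>t. A t = A0"
    using has_vector_derivative_zero_constant[OF convex_UNIV, of A] by (metis UNIV_I)
  show ?thesis
  proof
    show "transpose A0 = - A0"
      using skew[of 0] by (simp only: A0)
    have "\<gamma> t ** A0 = \<gamma>' t" for t
      unfolding A0[of t, symmetric] A_def
      by (simp only: matrix_mul_assoc orthogonal_matrix_mult_transpose[OF orth] matrix_mul_lid)
    then show "(\<gamma> has_vector_derivative \<gamma> t ** A0) (at t)" for t
      using d1 by simp
  qed
qed

text \<open>The solution of \<open>Y' = Y A\<close> commutes with \<open>A\<close>, hence \<open>Y(t) Y(-t)\<close> is constant.\<close>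

lemma orthogonal_one_parameter:
  fixes Y :: "real \<Rightarrow> real^'n^'n"
  assumes A: "transpose A = - A" and Y: "\<And>t. (Y has_vector_derivative Y t ** A) (at t)"
    and Y0: "Y 0 = mat 1" and orth: "\<And>t. orthogonal_matrix (Y t)"
  shows "Y t ** Y (- t) = mat 1"
proof -
  \<comment> \<open>The two terms of the derivative cancel because A^T = -A. So Y A Y^T keeps its
    value A at t = 0, and this says that Y commutes with A.\<close>
  have "((\<lambda>t. Y t ** A ** transpose (Y t)) has_vector_derivative 0) (at t)" for t
  proof -
    have "((\<lambda>t. Y t ** A ** transpose (Y t)) has_vector_derivative
        Y t ** A ** transpose (Y t ** A) + (Y t ** A) ** A ** transpose (Y t)) (at t)"
      by (rule has_vector_derivative_matrix_mult[OF has_vector_derivative_matrix_mult_const(2)[OF Y]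
            has_vector_derivative_transpose[OF Y]])
    moreover have "Y t ** A ** transpose (Y t ** A) + (Y t ** A) ** A ** transpose (Y t) = 0"
      by (simp add: transpose_simps A matrix_mult_simps)
    ultimately show ?thesis by (simp only:)
  qed
  then obtain C where C: "\<And>t. Y t ** A ** transpose (Y t) = C"
    using has_vector_derivative_zero_constant[OF convex_UNIV, of "\<lambda>t. Y t ** A ** transpose (Y t)"]
    by (metis UNIV_I)
  have "C = A"
    using C[of 0] by (simp add: Y0 transpose_mat)
  have comm: "Y t ** A = A ** Y t" for t
  proof -
    have "Y t ** A ** transpose (Y t) ** Y t = A ** Y t"
      by (simp only: C \<open>C = A\<close>)
    then show ?thesis
      by (simp only: matrix_mul_assoc[symmetric] orthogonal_matrix_transpose_mult[OF orth] matrix_mul_rid)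
  qed
  have dm: "((\<lambda>t. Y (- t)) has_vector_derivative - (Y (- t) ** A)) (at t)" for t
    using vector_diff_chain_at[of uminus "-1" t Y "Y (- t) ** A"] Y[of "- t"]
    by (simp add: o_def has_vector_derivative_minus[OF has_vector_derivative_id])
  have "((\<lambda>t. Y t ** Y (- t)) has_vector_derivative 0) (at t)" for t
  proof -
    have "((\<lambda>t. Y t ** Y (- t)) has_vector_derivative
        Y t ** - (Y (- t) ** A) + (Y t ** A) ** Y (- t)) (at t)"
      by (rule has_vector_derivative_matrix_mult[OF Y dm])
    moreover have "Y t ** - (Y (- t) ** A) + (Y t ** A) ** Y (- t) = 0"
      by (simp only: comm[of "- t"]) (simp add: matrix_mult_simps)
    ultimately show ?thesis by (simp only:)
  qed
  then obtain D where D: "\<And>t. Y t ** Y (- t) = D"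
    using has_vector_derivative_zero_constant[OF convex_UNIV, of "\<lambda>t. Y t ** Y (- t)"]
    by (metis UNIV_I)
  show ?thesis
    using D[of t] D[of 0] by (simp add: Y0)
qed

text \<open>Both endpoint factors in Y(1) Y(-1) = 1 equal X = G^T H. An orthogonal matrix that is
  its own inverse is also its own transpose.\<close>

lemma weakly_diametral_involution:
  fixes G H :: "real^'n^'n"
  assumes G: "orthogonal_matrix G" and "weakly_diametral G H"
  shows "transpose (transpose G ** H) = transpose G ** H"
    "(transpose G ** H) ** (transpose G ** H) = mat 1"
proof -
  obtain \<gamma> where \<gamma>: "geodesic orthogonal_group frobenius \<gamma>" "\<gamma> 0 = G" "\<gamma> 1 = H" "\<gamma> (-1) = H"
    using assms(2) unfolding weakly_diametral_def by blast
  have orth: "orthogonal_matrix (\<gamma> t)" for t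
    using \<gamma>(1) unfolding geodesic_def orthogonal_group_def by blast
  obtain A where A: "transpose A = - A" "\<And>t. (\<gamma> has_vector_derivative \<gamma> t ** A) (at t)"
    using geodesic_orthogonal_group_derivative[OF \<gamma>(1)] by blast
  let ?Y = "\<lambda>t. transpose G ** \<gamma> t"
  have oY: "orthogonal_matrix (?Y t)" for t
    using G orth by (simp add: orthogonal_matrix_mul orthogonal_matrix_transpose)
  have "?Y 1 ** ?Y (- 1) = mat 1"
  proof (rule orthogonal_one_parameter[OF A(1) _ _ oY])
    show "(?Y has_vector_derivative ?Y t ** A) (at t)" for t
      using has_vector_derivative_matrix_mult_const(1)[OF A(2)] by (simp only: matrix_mul_assoc)
    show "?Y 0 = mat 1"
      using orthogonal_matrix_transpose_mult[OF G] by (simp add: \<gamma>)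
  qed
  then show XX: "(transpose G ** H) ** (transpose G ** H) = mat 1"
    by (simp only: \<gamma>)
  let ?X = "transpose G ** H"
  have "transpose ?X ** ?X = mat 1"
    using oY[of 1] unfolding \<gamma>(3) by (rule orthogonal_matrix_transpose_mult)
  then have "transpose ?X ** (?X ** ?X) = ?X"
    by (simp only: matrix_mul_assoc matrix_mul_lid)
  then show "transpose ?X = ?X"
    by (simp only: XX matrix_mul_rid)
qed

section \<open>Weakly diametral pairs\<close>

text \<open>\<open>X\<close> is conjugate to a diagonal matrix with entries 1 and -1 of the same
  multiplicities, and conjugate matrices have the same determinant.\<close>

lemma det_symmetric_involution:
  fixes X :: "real^'n^'n"
  assumes X: "transpose X = X" "X ** X = mat 1"
  shows "det X = (- 1) ^ dim {x. X *v x = - x}"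
proof -
  let ?m = "dim {x. X *v x = - x}"
  have sum: "dim {x. X *v x = x} + ?m = CARD('n)"
    by (rule dim_symmetric_involution[OF X])
  then obtain I :: "'n set" where I: "card I = ?m"
    using obtain_subset_with_card_n[of ?m "UNIV :: 'n set"] by auto
  define D :: "real^'n^'n" where "D = (\<chi> i j. if i = j then if i \<in> I then - 1 else 1 else 0)"
  have Dx: "(D *v x) $ i = (if i \<in> I then - (x $ i) else x $ i)" for x i
  proof -
    have "(D *v x) $ i = (\<Sum>j\<in>UNIV. if j = i then if i \<in> I then - (x $ i) else x $ i else 0)"
      unfolding D_def matrix_vector_mult_def vec_lambda_beta by (rule sum.cong) auto
    then show ?thesis by simp
  qed
  have D: "transpose D = D" "D ** D = mat 1"
  proof -
    show "transpose D = D"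
      by (auto simp: D_def transpose_def vec_eq_iff)
    have "D *v (D *v x) = x" for x
      by (simp add: vec_eq_iff Dx)
    then show "D ** D = mat 1"
      unfolding matrix_eq by (simp add: matrix_vector_mul_assoc[symmetric])
  qed
  have "{x. D *v x = x} = {x. \<forall>i. i \<notin> - I \<longrightarrow> x $ i = 0}"
    by (auto simp: vec_eq_iff Dx split: if_splits)
  then have "dim {x. D *v x = x} = card (- I)"
    by (simp only: dim_vec_eq[symmetric] dim_substandard_cart)
  then have "dim {x. D *v x = x} = dim {x. X *v x = x}"
    using sum I by (simp add: Compl_eq_Diff_UNIV card_Diff_subset)
  then obtain Q where Q: "orthogonal_matrix Q" "X ** Q = Q ** D"
    by (rule symmetric_involutions_conjugate[OF D X])
  have "det Q \<noteq> 0"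
    using det_orthogonal_matrix[OF Q(1)] by auto
  then have "det X = det D"
    using arg_cong[OF Q(2), of det] by (simp add: det_mul)
  also have "\<dots> = (\<Prod>i\<in>UNIV. if i \<in> I then - 1 else 1)"
    by (subst det_diagonal) (simp_all add: D_def)
  also have "\<dots> = (- 1) ^ ?m"
    by (simp add: prod.If_cases I)
  finally show ?thesis .
qed

text \<open>The determinant is continuous and takes only the values 1 and -1 on the group, so it is
  constant on connected subsets.\<close>

lemma connected_component_orthogonal_group_det:
  fixes G H :: "real^'n^'n"
  assumes "connected_component orthogonal_group G H"
  shows "det G = det H"
proof -
  obtain T where T: "connected T" "T \<subseteq> orthogonal_group" "G \<in> T" "H \<in> T"
    using assms unfolding connected_component_def by blast
  have "continuous_on T (\<lambda>A :: real^'n^'n. det A)"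
    by (rule smooth_on_continuous_on[OF smooth_on_det[OF smooth_on_id]])
  moreover have "(\<lambda>A. det A) ` T \<subseteq> {1, - 1}"
    using T(2) det_orthogonal_matrix unfolding orthogonal_group_def by blast
  then have "finite ((\<lambda>A. det A) ` T)"
    by (rule finite_subset) simp
  ultimately have "(\<lambda>A. det A) constant_on T"
    by (rule continuous_finite_range_constant[OF T(1)])
  then show ?thesis
    using T(3,4) unfolding constant_on_def by metis
qed

lemma weakly_diametral_imp_sym_orthogonal:
  fixes G H :: "real^'n^'n"
  assumes G: "orthogonal_matrix G" and wd: "weakly_diametral G H"
  shows "\<exists>q\<in>{0..CARD('n) div 2}.
    H \<in> left_translation G ` sym_orthogonal (CARD('n) - 2 * q) (2 * q)"
proof -
  let ?X = "transpose G ** H"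
  note X = weakly_diametral_involution[OF assms]
  have "det G = det H"
    using wd unfolding weakly_diametral_def by (intro connected_component_orthogonal_group_det) blast
  then have "det ?X = 1"
    using det_orthogonal_matrix[OF G] by (auto simp: det_mul det_transpose)
  then have "even (dim {x. ?X *v x = - x})"
    using det_symmetric_involution[OF X] by (metis neg_one_odd_power numeral_eq_one_iff one_neq_neg_one)
  then obtain q where q: "dim {x. ?X *v x = - x} = 2 * q"
    by (rule evenE)
  then have "dim {x. ?X *v x = x} + 2 * q = CARD('n)"
    using dim_symmetric_involution[OF X] by simp
  then have "?X \<in> sym_orthogonal (CARD('n) - 2 * q) (2 * q)" "q \<in> {0..CARD('n) div 2}"
    using X q unfolding sym_orthogonal_iff by auto
  moreover have "H = left_translation G ?X"
    by (simp only: left_translation_def matrix_mul_assoc orthogonal_matrix_mult_transpose[OF G] matrix_mul_lid)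
  ultimately show ?thesis by blast
qed

text \<open>An orthonormal basis of the even-dimensional space is paired off and each pair rotated by a right angle.\<close>

lemma complex_structure_exists:
  fixes X :: "real^'n^'n"
  assumes X: "transpose X = X" "X ** X = mat 1" and even: "even (dim {x. X *v x = - x})"
  obtains J :: "real^'n^'n" where "transpose J = - J" "J ** J = - ((1/2) *\<^sub>R (mat 1 - X))" "J ** X = - J"
proof -
  let ?W = "{x. X *v x = - x}"
  have sW: "subspace ?W"
    using subspace_eigenspace[of X "-1"] by simp
  obtain B where B: "B \<subseteq> ?W" "pairwise orthogonal B" "\<And>x. x \<in> B \<Longrightarrow> norm x = 1"
    "independent B" "card B = dim ?W" "span B = ?W"
    by (rule orthonormal_basis_subspace[OF sW]) blast
  have fin: "finite B"
    using B(4) by (simp add: independent_imp_finite)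
  obtain q where q: "card B = 2 * q"
    using even B(5) by (metis evenE)
  obtain C where C: "C \<subseteq> B" "card C = q"
    using obtain_subset_with_card_n[of q B] q by auto
  have finC: "finite C"
    using C(1) fin by (rule finite_subset)
  have "card (B - C) = card C"
    using C q finC by (simp add: card_Diff_subset)
  then obtain h where h: "bij_betw h C (B - C)"
    using finite_same_card_bij[OF finC finite_Diff[OF fin], of C] by metis
  have hB: "h b \<in> B" "h b \<notin> C" if "b \<in> C" for b
    using h that by (auto simp: bij_betw_def)
  have hinj: "h b = h c \<longleftrightarrow> b = c" if "b \<in> C" "c \<in> C" for b c
    using h that by (auto simp: bij_betw_def inj_on_def)
  have ip: "b \<bullet> c = (if b = c then 1 else 0)" if "b \<in> B" "c \<in> B" for b c
    using B(2,3) that by (auto simp: pairwise_def orthogonal_def dot_square_norm)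
  \<comment> \<open>On each pair this is a right-angle rotation: \<open>b\<close> goes to
    \<open>h b\<close> and \<open>h b\<close> to \<open>- b\<close>. It vanishes on vectors
    orthogonal to \<open>B\<close>, that is, on ker(X - 1).\<close>
  define f where "f x = (\<Sum>b\<in>C. (x \<bullet> b) *\<^sub>R h b - (x \<bullet> h b) *\<^sub>R b)" for x :: "real^'n"
  have lin: "linear f"
    unfolding f_def by (intro linear_compose_sum ballI) (auto simp: linear_iff algebra_simps)
  have fb: "f b = h b" if "b \<in> C" for b
  proof -
    have "(b \<bullet> c) *\<^sub>R h c - (b \<bullet> h c) *\<^sub>R c = (if c = b then h b else 0)" if "c \<in> C" for c
    proof -
      have "b \<in> B" "c \<in> B" "b \<noteq> h c"
        using C(1) hB(2)[OF that] \<open>b \<in> C\<close> that by auto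
      then show ?thesis
        using ip[of b c] ip[of b "h c"] hB(1)[OF that] by simp
    qed
    then show ?thesis
      using finC that by (simp add: f_def)
  qed
  have fhb: "f (h b) = - b" if "b \<in> C" for b
  proof -
    have "(h b \<bullet> c) *\<^sub>R h c - (h b \<bullet> h c) *\<^sub>R c = (if c = b then - b else 0)" if "c \<in> C" for c
    proof -
      have "c \<in> B" "c \<noteq> h b"
        using C(1) hB(2)[OF \<open>b \<in> C\<close>] that by auto
      then show ?thesis
        using ip[of "h b" c] ip[of "h b" "h c"] hB(1)[OF that] hB(1)[OF \<open>b \<in> C\<close>]
          hinj[OF \<open>b \<in> C\<close> that] by auto
    qed
    then show ?thesis
      using finC that by (simp add: f_def)
  qed
  have ff: "f (f b) = - b" if "b \<in> B" for b
  proof (cases "b \<in> C")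
    case True
    then show ?thesis by (simp add: fb fhb)
  next
    case False
    then have "b \<in> h ` C"
      using that by (simp add: bij_betw_imp_surj_on[OF h])
    then obtain c where "b = h c" "c \<in> C" by (rule imageE)
    then show ?thesis by (simp add: fb fhb linear_neg[OF lin])
  qed
  have ffW: "f (f x) = - x" if "X *v x = - x" for x
  proof (rule linear_eq_on_span[of "\<lambda>x. f (f x)" uminus B])
    show "linear (\<lambda>x. f (f x))"
      using linear_compose[OF lin lin] by (simp add: o_def)
    show "linear (uminus :: real^'n \<Rightarrow> _)"
      by (simp add: linear_iff)
    show "x \<in> span B" using that B(6) by simp
  qed (rule ff)
  have fV: "f x = 0" if "X *v x = x" for x
  proof -
    have "x \<bullet> b = 0" if "b \<in> B" for b
    proof -
      have "X *v b = - b" using B(1) that by blast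
      then have "x \<bullet> b = - (x \<bullet> b)"
        using inner_matrix_vector[of X x b] X(1) \<open>X *v x = x\<close> by simp
      then show ?thesis by simp
    qed
    then show ?thesis
      using C(1) hB(1) by (auto simp: f_def intro!: sum.neutral)
  qed
  have fskew: "f x \<bullet> y = - (x \<bullet> f y)" for x y
    by (simp add: f_def inner_sum_left inner_sum_right inner_diff_left inner_diff_right
        inner_commute[of y] mult.commute flip: sum_negf)
  define J where "J = matrix f"
  have J: "J *v x = f x" for x
    by (simp add: J_def matrix_apply[OF lin])
  \<comment> \<open>As \<open>f\<close> kills the fixed component, it sees only the projection to
    ker(X + 1), where its square is -1.\<close>
  have decomp: "f x = f ((1/2) *\<^sub>R (x - X *v x))" for x
  proof -
    have "f x = f ((1/2) *\<^sub>R (x + X *v x) + (1/2) *\<^sub>R (x - X *v x))"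
      by (simp only: half_sum_diff)
    also have "\<dots> = f ((1/2) *\<^sub>R (x + X *v x)) + f ((1/2) *\<^sub>R (x - X *v x))"
      by (rule linear_add[OF lin])
    finally show ?thesis
      by (simp only: fV[OF involution_decomp(1)[OF X(2)]] add_0)
  qed
  show ?thesis
  proof
    have "x \<bullet> (transpose J *v y) = x \<bullet> ((- J) *v y)" for x y
      by (simp only: inner_matrix_vector[symmetric] J fskew matrix_vector_simps inner_minus_right)
    then show "transpose J = - J"
      unfolding matrix_eq by (metis vector_eq_ldot)
    have "f (f x) = - ((1/2) *\<^sub>R (x - X *v x))" for x
      unfolding decomp[of x] by (rule ffW[OF involution_decomp(2)[OF X(2)]])
    then show "J ** J = - ((1/2) *\<^sub>R (mat 1 - X))"
      unfolding matrix_eq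
      by (simp only: matrix_vector_mul_assoc[symmetric] J matrix_vector_simps) simp
    have "f (X *v x) = - f x" for x
    proof -
      have "X *v (X *v x) = x"
        using X(2) by (simp add: matrix_vector_mul_assoc)
      then have "f (X *v x) = f ((1/2) *\<^sub>R (X *v x - x))"
        using decomp[of "X *v x"] by simp
      also have "\<dots> = f (- ((1/2) *\<^sub>R (x - X *v x)))"
        by (simp only: scaleR_minus_right[symmetric] minus_diff_eq)
      also have "\<dots> = - f x"
        by (simp only: linear_neg[OF lin] decomp[of x, symmetric])
      finally show ?thesis .
    qed
    then show "J ** X = - J"
      unfolding matrix_eq
      by (simp only: matrix_vector_mul_assoc[symmetric] J matrix_vector_simps) simp
  qed
qed

text \<open>The derivative has the same shape, with (a, b) replaced by (c b, -c a). Smoothness and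
  second derivatives then follow by repeated use.\<close>

lemma has_vector_derivative_cos_sin:
  "((\<lambda>t. cos (c * t) *\<^sub>R a + sin (c * t) *\<^sub>R b) has_vector_derivative
    cos (c * t) *\<^sub>R (c *\<^sub>R b) + sin (c * t) *\<^sub>R (- c *\<^sub>R a)) (at t)"
proof -
  have "((\<lambda>t. cos (c * t)) has_real_derivative - sin (c * t) * c) (at t)"
    "((\<lambda>t. sin (c * t)) has_real_derivative cos (c * t) * c) (at t)"
    by (auto intro!: derivative_eq_intros)
  then have "((\<lambda>t. cos (c * t) *\<^sub>R a + sin (c * t) *\<^sub>R b) has_vector_derivative
      (cos (c * t) *\<^sub>R 0 + (- sin (c * t) * c) *\<^sub>R a) + (sin (c * t) *\<^sub>R 0 + (cos (c * t) * c) *\<^sub>R b)) (at t)"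
    by (intro has_vector_derivative_add has_vector_derivative_scaleR has_vector_derivative_const)
  then show ?thesis by (simp add: add.commute)
qed

lemma smooth_on_cos_sin:
  fixes a b :: "'a::euclidean_space"
  shows "smooth_on S (\<lambda>t. cos (c * t) *\<^sub>R a + sin (c * t) *\<^sub>R b)"
proof -
  have "Ck_on k UNIV (\<lambda>t. cos (c * t) *\<^sub>R a + sin (c * t) *\<^sub>R b)" for k
  proof (induction k arbitrary: a b)
    case 0
    then show ?case by (auto intro!: continuous_intros)
  next
    case (Suc k)
    show ?case
    proof (rule Ck_on_SucI[OF open_UNIV])
      show "((\<lambda>t. cos (c * t) *\<^sub>R a + sin (c * t) *\<^sub>R b) has_derivative
          (\<lambda>v. v *\<^sub>R (cos (c * t) *\<^sub>R (c *\<^sub>R b) + sin (c * t) *\<^sub>R (- c *\<^sub>R a)))) (at t)" for t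
        using has_vector_derivative_cos_sin by (simp only: has_vector_derivative_def)
      have e: "v *\<^sub>R (cos (c * t) *\<^sub>R (c *\<^sub>R b) + sin (c * t) *\<^sub>R (- c *\<^sub>R a))
          = cos (c * t) *\<^sub>R (v *\<^sub>R c *\<^sub>R b) + sin (c * t) *\<^sub>R (v *\<^sub>R (- c) *\<^sub>R a)" for v t
        by (simp add: algebra_simps)
      show "Ck_on k UNIV (\<lambda>t. v *\<^sub>R (cos (c * t) *\<^sub>R (c *\<^sub>R b) + sin (c * t) *\<^sub>R (- c *\<^sub>R a)))" for v
        unfolding e by (rule Suc)
    qed
  qed
  then have "smooth_on UNIV (\<lambda>t. cos (c * t) *\<^sub>R a + sin (c * t) *\<^sub>R b)"
    by (simp add: smooth_on_open_iff[OF open_UNIV])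
  then show ?thesis
    by (rule smooth_on_subset) simp
qed

text \<open>The curve is G exp(pi t J) in closed form: with p and q the projections to ker(X - 1)
  and ker(X + 1), J^2 = -q gives exp(s J) = p + cos(s) q + sin(s) J. At s = pi and s = -pi this is p
  - q = X.\<close>

lemma geodesic_through_involution:
  fixes G X J :: "real^'n^'n"
  assumes G: "orthogonal_matrix G" and X: "transpose X = X" "X ** X = mat 1"
    and J: "transpose J = - J" "J ** J = - ((1/2) *\<^sub>R (mat 1 - X))" "J ** X = - J"
  defines "\<gamma> \<equiv> \<lambda>t. G ** ((1/2) *\<^sub>R (mat 1 + X) + (cos (pi * t) *\<^sub>R ((1/2) *\<^sub>R (mat 1 - X)) + sin (pi * t) *\<^sub>R J))"
  shows "geodesic orthogonal_group frobenius \<gamma>" "\<gamma> 0 = G" "\<gamma> 1 = G ** X" "\<gamma> (-1) = G ** X"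
proof -
  define p q where "p = (1/2) *\<^sub>R (mat 1 + X)" and "q = (1/2) *\<^sub>R (mat 1 - X)"
  have pq: "p + q = mat 1" "p - q = X"
    unfolding p_def q_def by (rule half_sum_diff, rule half_diff_diff)
  have XJ: "X ** J = - J"
  proof -
    have "- (X ** J) = J"
      using arg_cong[OF J(3), of transpose] X(1) J(1) by (simp add: transpose_simps matrix_mult_simps)
    then show ?thesis by (metis minus_minus)
  qed
  have t: "transpose p = p" "transpose q = q"
    using X(1) by (simp_all add: p_def q_def transpose_simps)
  have qq: "q ** q = q"
  proof -
    have "q ** q = (1/2) *\<^sub>R ((1/2) *\<^sub>R (mat 1 - X) + (1/2) *\<^sub>R (mat 1 - X))"
      by (simp add: q_def matrix_mult_simps X(2) algebra_simps)
    also have "\<dots> = q"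
      unfolding q_def by (simp flip: scaleR_add_left)
    finally show ?thesis .
  qed
  have pe: "p = mat 1 - q"
    using pq(1) by (simp add: eq_diff_eq)
  have qJ: "q ** J = J" and Jq: "J ** q = J"
    by (simp_all add: q_def matrix_mult_simps XJ J(3) flip: scaleR_add_left)
  have prods: "p ** p = p" "p ** q = 0" "q ** p = 0" "p ** J = 0" "J ** p = 0" "J ** J = - q"
    using qq qJ Jq J(2) by (simp_all add: pe matrix_mult_simps q_def[symmetric])
  define M where "M t = p + (cos (pi * t) *\<^sub>R q + sin (pi * t) *\<^sub>R J)" for t
  have \<gamma>: "\<gamma> t = G ** M t" for t
    by (simp add: \<gamma>_def M_def p_def q_def)
  show "\<gamma> 0 = G" "\<gamma> 1 = G ** X" "\<gamma> (-1) = G ** X"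
    using pq by (simp_all add: \<gamma> M_def)
  have Mt: "transpose (M t) = p + (cos (pi * t) *\<^sub>R q - sin (pi * t) *\<^sub>R J)" for t
    by (simp add: M_def transpose_simps t J(1))
  \<comment> \<open>The second factor is \<open>M t ** q\<close>, so this is orthogonality of
    \<open>M t\<close> on ker(X + 1). It is used again to rewrite the acceleration.\<close>
  have M1: "transpose (M t) ** (cos (pi * t) *\<^sub>R q + sin (pi * t) *\<^sub>R J) = q" for t
  proof -
    have "transpose (M t) ** (cos (pi * t) *\<^sub>R q + sin (pi * t) *\<^sub>R J)
        = (cos (pi * t) * cos (pi * t)) *\<^sub>R q + (sin (pi * t) * sin (pi * t)) *\<^sub>R q"
      by (simp add: Mt matrix_mult_simps prods qq qJ Jq algebra_simps)
    also have "\<dots> = (cos (pi * t) * cos (pi * t) + sin (pi * t) * sin (pi * t)) *\<^sub>R q"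
      by (simp only: scaleR_add_left)
    also have "cos (pi * t) * cos (pi * t) + sin (pi * t) * sin (pi * t) = 1"
      using sin_cos_squared_add2[of "pi * t"] by (simp only: power2_eq_square)
    finally show ?thesis by (simp only: scaleR_one)
  qed
  have "transpose (M t) ** M t = mat 1" for t
  proof -
    have "transpose (M t) ** M t = transpose (M t) ** p + transpose (M t) ** (cos (pi * t) *\<^sub>R q + sin (pi * t) *\<^sub>R J)"
      unfolding M_def[of t] by (simp only: matrix_mult_simps(2))
    also have "\<dots> = p + q"
      unfolding M1 by (simp add: Mt matrix_mult_simps prods)
    finally show ?thesis by (simp only: pq)
  qed
  then have Morth: "orthogonal_matrix (M t)" for t
    by (simp add: orthogonal_matrix)
  have orth: "orthogonal_matrix (\<gamma> t)" for t
    unfolding \<gamma> by (rule orthogonal_matrix_mul[OF G Morth])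
  have sm: "smooth_on UNIV \<gamma>"
    unfolding \<gamma>_def
    by (rule smooth_on_matrix_mult_const(1)[OF smooth_on_add[OF smooth_on_const smooth_on_cos_sin]])
  have v1: "vector_derivative \<gamma> (at s) = G ** (cos (pi * s) *\<^sub>R (pi *\<^sub>R J) + sin (pi * s) *\<^sub>R (- pi *\<^sub>R q))" for s
  proof (rule vector_derivative_at)
    have "((\<lambda>t. G ** M t) has_vector_derivative
        G ** (0 + (cos (pi * s) *\<^sub>R (pi *\<^sub>R J) + sin (pi * s) *\<^sub>R (- pi *\<^sub>R q)))) (at s)"
      unfolding M_def
      by (rule has_vector_derivative_matrix_mult_const(1)[OF has_vector_derivative_add[OF
            has_vector_derivative_const has_vector_derivative_cos_sin]])
    then show "(\<gamma> has_vector_derivative G ** (cos (pi * s) *\<^sub>R (pi *\<^sub>R J) + sin (pi * s) *\<^sub>R (- pi *\<^sub>R q))) (at s)"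
      by (simp only: \<gamma>[abs_def] add_0)
  qed
  have v2: "vector_derivative (\<lambda>s. vector_derivative \<gamma> (at s)) (at t) =
      - (pi * pi) *\<^sub>R (G ** (cos (pi * t) *\<^sub>R q + sin (pi * t) *\<^sub>R J))" for t
  proof -
    have "vector_derivative (\<lambda>s. vector_derivative \<gamma> (at s)) (at t) =
        G ** (cos (pi * t) *\<^sub>R (pi *\<^sub>R (- pi *\<^sub>R q)) + sin (pi * t) *\<^sub>R (- pi *\<^sub>R (pi *\<^sub>R J)))"
      unfolding v1
      by (rule vector_derivative_at[OF has_vector_derivative_matrix_mult_const(1)[OF has_vector_derivative_cos_sin]])
    then show ?thesis
      by (simp add: matrix_mult_simps algebra_simps)
  qed
  show "geodesic orthogonal_group frobenius \<gamma>"
    unfolding geodesic_def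
  proof (intro conjI allI ballI sm)
    show "range \<gamma> \<subseteq> orthogonal_group"
      using orth by (auto simp: orthogonal_group_def)
    fix t v assume "v \<in> tangent_space orthogonal_group (\<gamma> t)"
    then have skew: "transpose (transpose (\<gamma> t) ** v) = - (transpose (\<gamma> t) ** v)"
      by (rule tangent_space_orthogonal_groupD)
    let ?N = "cos (pi * t) *\<^sub>R q + sin (pi * t) *\<^sub>R J"
    \<comment> \<open>The acceleration is thus -pi^2 times \<open>\<gamma> t ** q\<close>. Its
      product with a tangent vector v pairs the symmetric \<open>q\<close> with the skew matrix
      \<gamma>(t)^T v, which gives 0.\<close>
    have "G ** ?N = \<gamma> t ** q"
    proof -
      have "M t ** q = M t ** (transpose (M t) ** ?N)"
        by (simp only: M1)
      then have "M t ** q = ?N"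
        by (simp only: matrix_mul_assoc orthogonal_matrix_mult_transpose[OF Morth] matrix_mul_lid)
      then show ?thesis
        by (simp only: \<gamma> matrix_mul_assoc[symmetric])
    qed
    then have "(G ** ?N) \<bullet> v = q \<bullet> (transpose (\<gamma> t) ** v)"
      using inner_matrix_mult[of "transpose (\<gamma> t)" q v] by (simp only: transpose_transpose)
    also have "\<dots> = 0"
      by (rule inner_symmetric_skew[OF t(2) skew])
    finally show "frobenius (vector_derivative (\<lambda>s. vector_derivative \<gamma> (at s)) (at t)) v = 0"
      by (simp add: v2 frobenius_eq_inner)
  qed
qed

text \<open>The image of the geodesic is itself a connected subset of the group containing both
  points, which settles the connected-component condition.\<close>

lemma sym_orthogonal_imp_weakly_diametral:
  fixes G X :: "real^'n^'n"
  assumes G: "orthogonal_matrix G" and X: "X \<in> sym_orthogonal p (2 * q)"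
  shows "weakly_diametral G (G ** X)"
proof -
  have Xs: "transpose X = X" "X ** X = mat 1" and "even (dim {x. X *v x = - x})"
    using X by (simp_all add: sym_orthogonal_iff)
  then obtain J where J: "transpose J = - J" "J ** J = - ((1/2) *\<^sub>R (mat 1 - X))" "J ** X = - J"
    using complex_structure_exists by blast
  obtain \<gamma> where \<gamma>: "geodesic orthogonal_group frobenius \<gamma>" "\<gamma> 0 = G" "\<gamma> 1 = G ** X" "\<gamma> (-1) = G ** X"
    using geodesic_through_involution[OF G Xs J] by blast
  have "smooth_on UNIV \<gamma>" "range \<gamma> \<subseteq> orthogonal_group"
    using \<gamma>(1) by (simp_all add: geodesic_def)
  moreover have "connected (range \<gamma>)"
    by (rule connected_continuous_image[OF smooth_on_continuous_on[OF \<open>smooth_on UNIV \<gamma>\<close>] connected_UNIV])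
  moreover have "G \<in> range \<gamma>" "G ** X \<in> range \<gamma>"
    using \<gamma>(2,3) by (metis rangeI)+
  ultimately have "connected_component orthogonal_group G (G ** X)"
    unfolding connected_component_def by blast
  then show ?thesis
    unfolding weakly_diametral_def using \<gamma> by blast
qed

theorem proposition4p17:
  fixes G :: "real^'n^'n"
  assumes "G \<in> orthogonal_group"
  shows "{H \<in> orthogonal_group. weakly_diametral G H} =
           (\<Union>q\<in>{0..CARD('n) div 2}.
              left_translation G ` sym_orthogonal (CARD('n) - 2 * q) (2 * q)) \<and>
         disjoint_family_on
           (\<lambda>q. left_translation G ` sym_orthogonal (CARD('n) - 2 * q) (2 * q))
           {0..CARD('n) div 2} \<and>
         (\<forall>q\<in>{0..CARD('n) div 2}.
            let S = left_translation G ` sym_orthogonal (CARD('n) - 2 * q) (2 * q);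
                k = CARD('n) - 2 * q
            in submanifold orthogonal_group_atlas S \<and>
               diffeomorphic S (slice_atlas orthogonal_group_atlas S)
                 (grassmannian k :: (real^'n) set set) (grassmannian_atlas k))"
proof (intro conjI ballI)
  let ?S = "\<lambda>q. left_translation G ` sym_orthogonal (CARD('n) - 2 * q) (2 * q)"
  have G: "orthogonal_matrix G"
    using assms by (simp add: orthogonal_group_def)
  show "{H \<in> orthogonal_group. weakly_diametral G H} = (\<Union>q\<in>{0..CARD('n) div 2}. ?S q)"
  proof (intro set_eqI iffI)
    fix H assume "H \<in> {H \<in> orthogonal_group. weakly_diametral G H}"
    then show "H \<in> (\<Union>q\<in>{0..CARD('n) div 2}. ?S q)"
      using weakly_diametral_imp_sym_orthogonal[OF G] by blast
  next
    fix H assume "H \<in> (\<Union>q\<in>{0..CARD('n) div 2}. ?S q)"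
    then obtain q where q: "H \<in> ?S q" by blast
    then have "weakly_diametral G H"
      using sym_orthogonal_imp_weakly_diametral[OF G] unfolding left_translation_def by blast
    moreover have "H \<in> orthogonal_group"
      using q left_translation_sym_orthogonal_subset[OF G] by blast
    ultimately show "H \<in> {H \<in> orthogonal_group. weakly_diametral G H}" by blast
  qed
  show "disjoint_family_on ?S {0..CARD('n) div 2}"
    unfolding disjoint_family_on_def
  proof (intro ballI impI equals0I)
    fix q r H assume "q \<noteq> r" "H \<in> ?S q \<inter> ?S r"
    then obtain X Y where XY: "X \<in> sym_orthogonal (CARD('n) - 2 * q) (2 * q)"
      "Y \<in> sym_orthogonal (CARD('n) - 2 * r) (2 * r)" and "H = G ** X" "H = G ** Y"
      unfolding left_translation_def by (elim IntE imageE)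
    then have "G ** X = G ** Y" by (simp only:)
    then have "(transpose G ** G) ** X = (transpose G ** G) ** Y"
      by (simp only: matrix_mul_assoc[symmetric])
    then have "X = Y"
      by (simp only: orthogonal_matrix_transpose_mult[OF G] matrix_mul_lid)
    then show False
      using XY \<open>q \<noteq> r\<close> by (simp add: sym_orthogonal_iff)
  qed
  fix q assume "q \<in> {0..CARD('n) div 2}"
  \<comment> \<open>The bound on \<open>q\<close> keeps the subtraction of natural numbers from
    truncating.\<close>
  then have "CARD('n) - 2 * q + 2 * q = CARD('n)" by auto
  then show "let S = ?S q; k = CARD('n) - 2 * q
      in submanifold orthogonal_group_atlas S \<and>
        diffeomorphic S (slice_atlas orthogonal_group_atlas S)
          (grassmannian k :: (real^'n) set set) (grassmannian_atlas k)"
    unfolding Let_def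
    using submanifold_left_translation_sym_orthogonal[OF G]
      diffeomorphic_left_translation_sym_orthogonal[OF G] by blast
qed

end
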